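(* Let $\mu$ be a pointwise doubling measure on a separable, finite or infinite dimensional Hilbert space $H$, and let $m\ge 1$ be an integer. Then the following are equivalent: (1) for $\mu$-a.e. $x\in H$ there are an $m$-plane $V$ and an $\alpha\in(0,1)$ such that $$\lim_{r\downarrow 0}\frac{\mu(C_{\mathcal B}(x,r,V,\alpha))}{\mu(B(x,r))}=0;$$ (2) $\mu$ is carried by ($m$-dimensional) Lipschitz graphs.
   Context: $B(x,r)$ denotes the closed ball with center $x$ and radius $r$. Pointwise doubling: a Borel measure $\mu$ on $H$ is pointwise doubling if $\mu$ is finite on bounded sets and for $\mu$-a.e. $x$, $\limsup_{r\downarrow 0}\mu(B(x,2r))/\mu(B(x,r))<\infty$. An $m$-plane is an $m$-dimensional linear subspace $V$ of $H$. The good cone at $x$ with respect to $V$ and $\alpha$ is $C_{\mathcal G}(x,V,\alpha)=\{y\in H:\operatorname{dist}(y-x,V)\le\alpha|x-y|\}$; the bad cone is $C_{\mathcal B}(x,V,\alpha)=H\setminus C_{\mathcal G}(x,V,\alpha)$; and $C_{\mathcal B}(x,r,V,\alpha)=C_{\mathcal B}(x,V,\alpha)\cap B(x,r)$. Lipschitz graph: if $V$ is an $m$-plane and $f:V\to V^\perp$ is $L$-Lipschitz, the set $\Gamma=\{(v,f(v)):v\in V\}\subset V\oplus V^\perp=H$ is an ($m$-dimensional) $L$-Lipschitz graph. The measure $\mu$ is carried by Lipschitz graphs if there are countably many $m$-dimensional Lipschitz graphs $\Gamma_i$ (with any finite Lipschitz constants) such that $\mu(H\setminus\bigcup_i\Gamma_i)=0$.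 *)

theory Defs
  imports "HOL-Analysis.Analysis"
begin

text \<open>
  A separable real Hilbert space, of finite or infinite dimension, is a type of sort
  \<open>{real_inner, polish_space}\<close>; \<open>polish_space\<close> says that the norm metric is complete and has a
  countable base.
\<close>

text \<open>
  The quotient is taken in \<open>ennreal\<close>, where \<open>0 / 0 = 0\<close>. The convention is
  immaterial: a ball of measure zero occurs only around points outside the support of \<open>\<mu>\<close>,
  and these form a null set because the space is separable.
\<close>

definition pointwise_doubling :: "'a::{real_inner, polish_space} measure \<Rightarrow> bool" where
  "pointwise_doubling \<mu> \<longleftrightarrow>
     sets \<mu> = sets borel \<and>
     (\<forall>A \<in> sets \<mu>. bounded A \<longrightarrow> emeasure \<mu> A < \<infinity>) \<and>
     (AE x in \<mu>. Limsup (at_right 0)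
        (\<lambda>r::real. emeasure \<mu> (cball x (2 * r)) / emeasure \<mu> (cball x r)) < \<infinity>)"

text \<open>
  The finite spanning set is required explicitly because \<open>dim\<close> is \<open>0\<close> on infinite-dimensional
  subspaces.
\<close>

definition m_plane :: "nat \<Rightarrow> 'a::real_inner set \<Rightarrow> bool" where
  "m_plane m V \<longleftrightarrow> subspace V \<and> (\<exists>B. finite B \<and> span B = V) \<and> dim V = m"

definition good_cone :: "'a::real_inner \<Rightarrow> 'a set \<Rightarrow> real \<Rightarrow> 'a set" where
  "good_cone x V \<alpha> = {y. infdist (y - x) V \<le> \<alpha> * norm (x - y)}"

definition bad_cone :: "'a::real_inner \<Rightarrow> 'a set \<Rightarrow> real \<Rightarrow> 'a set" where
  "bad_cone x V \<alpha> = UNIV - good_cone x V \<alpha>"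

definition bad_cone_ball :: "'a::real_inner \<Rightarrow> real \<Rightarrow> 'a set \<Rightarrow> real \<Rightarrow> 'a set" where
  "bad_cone_ball x r V \<alpha> = bad_cone x V \<alpha> \<inter> cball x r"

text \<open>
  The orthogonal decomposition \<open>H = V \<oplus> V\<^sup>\<bottom>\<close> identifies the pair \<open>(v, f v)\<close> with
  \<open>v + f v\<close>. Values of \<open>f\<close> outside \<open>V\<close> play no role.
\<close>

definition lipschitz_graph :: "nat \<Rightarrow> real \<Rightarrow> 'a::real_inner set \<Rightarrow> bool" where
  "lipschitz_graph m L \<Gamma> \<longleftrightarrow>
     (\<exists>V f. m_plane m V \<and> f ` V \<subseteq> V\<^sup>\<bottom> \<and>
            L-lipschitz_on V f \<and> \<Gamma> = (\<lambda>v. v + f v) ` V)"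

text \<open>
  The family may be finite or empty, so that the zero measure is carried by \<open>m\<close>-dimensional
  Lipschitz graphs even when the space has dimension less than \<open>m\<close>. The Lipschitz graphs
  are closed, so the exceptional set below is Borel.
\<close>

definition carried_by_lipschitz_graphs ::
  "nat \<Rightarrow> 'a::{real_inner, polish_space} measure \<Rightarrow> bool" where
  "carried_by_lipschitz_graphs m \<mu> \<longleftrightarrow>
     (\<exists>G. countable G \<and> (\<forall>\<Gamma> \<in> G. \<exists>L. lipschitz_graph m L \<Gamma>) \<and>
          emeasure \<mu> (UNIV - \<Union>G) = 0)"

end

theory Submission
  imports Defs
begin

text \<open>
  \<^emph>\<open>From graphs to cones.\<close> A Lipschitz graph over \<open>V\<close> lies inside the good cone of a fixed aperture
  below \<open>1\<close> at each of its points (\<open>lipschitz_graph_in_good_cones\<close>). The bad cone at a point of the graph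
  therefore lies in the complement of the graph, and that complement has density zero at almost
  every point of the graph: Lebesgue's density theorem holds for pointwise doubling measures
  (\<open>pointwise_doubling_density\<close>), by a Vitali covering argument that uses no finite dimension.

  \<^emph>\<open>From cones to graphs.\<close> Suppose first that \<open>V\<close>, \<open>\<alpha>\<close>, the doubling constant and the range of
  radii are the same for all points of a set of small diameter. If \<open>y\<close> were well outside the good cone
  at \<open>x\<close>, a ball around \<open>y\<close> of radius comparable to \<open>dist x y\<close> would lie in the bad cone at \<open>x\<close>. By
  doubling such a ball has a definite share of the mass near \<open>x\<close>, contradicting the decay of the
  bad cone (\<open>cone_piece_imp_good_cone\<close>). So any two points of the set satisfy a cone condition; the
  set is the graph of a Lipschitz map on a subset of \<open>V\<close>, and Kirszbraun's theorem (\<open>kirszbraun\<close>) extends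
  that map to \<open>V\<close> (\<open>good_cone_condition_imp_graph\<close>). In general, countably many choices of the
  parameters cover almost every point: the \<open>m\<close>-planes form a separable family, and a small change of
  the plane is absorbed by a slightly wider cone (\<open>good_cone_perturb\<close>).
\<close>

section \<open>Extending Lipschitz maps between Hilbert spaces\<close>

text \<open>
The point \<open>p\<close> solves a concave maximisation problem. A convex combination of the pairs
\<open>(x, y) \<in> R\<close>, together with the same combination \<open>a\<close> of the numbers \<open>\<bar>y\<bar>\<^sup>2 - \<bar>x\<bar>\<^sup>2\<close>, is a point
\<open>(x, y, a)\<close> of the convex hull \<open>K\<close>, and the function to maximise on \<open>K\<close> is \<open>g = a - \<bar>y\<bar>\<^sup>2\<close>.

For two of the generating points, \<open>\<bar>y - y'\<bar> \<le> \<bar>x - x'\<bar>\<close> reads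
\<open>a + a' \<le> 2 (y \<bullet> y' - x \<bullet> x')\<close>. This is affine in each of the two points separately, so it holds
for any two points of \<open>K\<close>; for equal points it gives \<open>a \<le> \<bar>y\<bar>\<^sup>2 - \<bar>x\<bar>\<^sup>2\<close>, hence \<open>g \<le> 0\<close>.
Since \<open>g\<close> is strongly concave in \<open>y\<close>, the \<open>y\<close>-components of a maximising sequence converge without
any compactness. Their limit is \<open>p\<close>: the inequality \<open>\<bar>p - y\<bar>\<^sup>2 \<le> sup g + \<bar>x\<bar>\<^sup>2 \<le> \<bar>x\<bar>\<^sup>2\<close> is the first-order
condition that moving towards the generator of \<open>(x, y)\<close> does not raise \<open>g\<close> above its supremum.
\<close>

lemma kirszbraun_point:
  fixes R :: "('a::real_inner \<times> 'b::{real_inner,complete_space}) set"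
  assumes contr: "\<And>x y x' y'. (x, y) \<in> R \<Longrightarrow> (x', y') \<in> R \<Longrightarrow> norm (y - y') \<le> norm (x - x')"
  shows "\<exists>p. \<forall>(x, y) \<in> R. norm (p - y) \<le> norm x"
proof (cases "R = {}")
  case False
  define T where "T = (\<lambda>(x, y). (x, y, (norm y)\<^sup>2 - (norm x)\<^sup>2)) ` R"
  define K where "K = convex hull T"
  define g where "g z = snd (snd z) - (norm (fst (snd z)))\<^sup>2" for z :: "'a \<times> 'b \<times> real"
  \<comment> \<open>The half-space of the points \<open>(x', y', a')\<close> with \<open>a + a' \<le> 2 (y \<bullet> y' - x \<bullet> x')\<close>.\<close>
  let ?h = "\<lambda>x y (a::real). {z. inner (2 *\<^sub>R x, - 2 *\<^sub>R y, 1) z \<le> - a}"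
  have gen: "(x', y', a') \<in> ?h x y a" if "(x, y, a) \<in> T" "(x', y', a') \<in> T" for x y a x' y' a'
  proof -
    have "(norm (y - y'))\<^sup>2 \<le> (norm (x - x'))\<^sup>2"
      using that contr by (intro power_mono) (auto simp: T_def)
    then show ?thesis
      using that by (auto simp: T_def power2_norm_eq_inner inner_diff inner_commute)
  qed
  have hull1: "(x', y', a') \<in> ?h x y a" if "(x, y, a) \<in> T" "(x', y', a') \<in> K" for x y a x' y' a'
  proof -
    have "K \<subseteq> ?h x y a"
      unfolding K_def by (intro hull_minimal convex_halfspace_le) (use gen that in auto)
    then show ?thesis using that by blast
  qed
  have hull2: "(x', y', a') \<in> ?h x y a" if "(x, y, a) \<in> K" "(x', y', a') \<in> K" for x y a x' y' a'
  proof -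
    have "K \<subseteq> ?h x' y' a'"
      unfolding K_def
    proof (intro hull_minimal convex_halfspace_le subsetI)
      fix z assume "z \<in> T"
      then obtain u v b where z: "z = (u, v, b)" "(u, v, b) \<in> T" by (cases z) auto
      show "z \<in> ?h x' y' a'"
        using hull1[OF z(2) that(2)] by (simp add: z inner_commute)
    qed
    then show ?thesis using that by (auto simp: inner_commute)
  qed
  have g_le: "g z \<le> 0" if "z \<in> K" for z
  proof -
    obtain x y a where z: "z = (x, y, a)" by (cases z) auto
    have "2 * (norm x)\<^sup>2 - 2 * (norm y)\<^sup>2 + a \<le> - a"
      using hull2[of x y a x y a] that z by (simp add: power2_norm_eq_inner)
    then have "a \<le> (norm y)\<^sup>2"
      using zero_le_power2[of "norm x"] by linarith
    then show ?thesis by (simp add: z g_def)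
  qed
  have g_comb: "g ((1 - t) *\<^sub>R z + t *\<^sub>R w)
      = (1 - t) * g z + t * g w + t * (1 - t) * (norm (fst (snd z) - fst (snd w)))\<^sup>2" for t z w
    by (simp add: g_def power2_norm_eq_inner inner_diff inner_add inner_commute algebra_simps)
  define M where "M = (SUP z\<in>K. g z)"
  have "K \<noteq> {}" using False by (simp add: K_def T_def)
  have bdd: "bdd_above (g ` K)" using g_le by (auto intro!: bdd_aboveI2)
  have M_ub: "g z \<le> M" if "z \<in> K" for z
    unfolding M_def using that bdd by (rule cSUP_upper)
  have "M \<le> 0"
    unfolding M_def using \<open>K \<noteq> {}\<close> g_le by (rule cSUP_least)
  have "\<exists>z\<in>K. M - inverse (real (Suc n)) < g z" for n
    using less_cSUP_iff[OF \<open>K \<noteq> {}\<close> bdd, of "M - inverse (real (Suc n))"] by (simp add: M_def)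
  then obtain z where zK: "\<And>n. z n \<in> K" and zM: "\<And>n. M - inverse (real (Suc n)) < g (z n)"
    by metis
  have "convex K" by (simp add: K_def)
  have conv: "(1 - t) *\<^sub>R u + t *\<^sub>R w \<in> K" if "u \<in> K" "w \<in> K" "0 \<le> t" "t \<le> 1" for u w t
    using \<open>convex K\<close> that by (simp add: convex_alt)
  define p where "p n = fst (snd (z n))" for n
  \<comment> \<open>Compare \<open>M\<close> with the value of \<open>g\<close> at the midpoint of two members of the sequence.\<close>
  have gap: "(norm (p k - p n))\<^sup>2 \<le> 4 * inverse (real (Suc N))" if "k \<ge> N" "n \<ge> N" for k n N
  proof -
    have "(1 / 2) * g (z k) + (1 / 2) * g (z n) + (1 / 4) * (norm (p k - p n))\<^sup>2 \<le> M"
      using M_ub[OF conv[OF zK[of k] zK[of n], of "1/2"]] g_comb[of "1/2" "z k" "z n"] by (simp add: p_def)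
    moreover have "inverse (real (Suc k)) \<le> inverse (real (Suc N))"
      "inverse (real (Suc n)) \<le> inverse (real (Suc N))"
      using that by (auto intro!: le_imp_inverse_le)
    ultimately show ?thesis using zM[of k] zM[of n] by linarith
  qed
  have "Cauchy p"
  proof (rule CauchyI)
    fix e :: real assume "e > 0"
    then obtain N where N: "inverse (real (Suc N)) < e\<^sup>2 / 4"
      using reals_Archimedean[of "e\<^sup>2 / 4"] by auto
    have "norm (p k - p n) < e" if "k \<ge> N" "n \<ge> N" for k n
    proof (rule power2_less_imp_less)
      show "(norm (p k - p n))\<^sup>2 < e\<^sup>2" using gap[OF that] N by linarith
    qed (use \<open>e > 0\<close> in simp)
    then show "\<exists>N. \<forall>k\<ge>N. \<forall>n\<ge>N. norm (p k - p n) < e" by blast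
  qed
  then obtain q where q: "p \<longlonglongrightarrow> q" using Cauchy_convergent convergent_def by blast
  have gz: "(\<lambda>n. g (z n)) \<longlonglongrightarrow> M"
  proof (rule tendsto_sandwich)
    show "(\<lambda>n. M - inverse (real (Suc n))) \<longlonglongrightarrow> M"
      using tendsto_diff[OF tendsto_const[of M] LIMSEQ_inverse_real_of_nat] by simp
    show "\<forall>\<^sub>F n in sequentially. M - inverse (real (Suc n)) \<le> g (z n)"
      using zM by (intro always_eventually allI less_imp_le)
  qed (use M_ub[OF zK] in auto)
  have "norm (q - y) \<le> norm x" if "(x, y) \<in> R" for x y
  proof -
    let ?w = "(x, y, (norm y)\<^sup>2 - (norm x)\<^sup>2)"
    have "?w \<in> T" using that unfolding T_def by force
    then have w: "?w \<in> K" unfolding K_def by (rule hull_inc)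
    have gw: "g ?w = - (norm x)\<^sup>2" by (simp add: g_def)
    \<comment> \<open>Move a fraction \<open>t\<close> of the way to \<open>?w\<close>, let the sequence converge, and divide by \<open>t\<close>.\<close>
    have step: "(1 - t) * (norm (q - y))\<^sup>2 \<le> M + (norm x)\<^sup>2" if t: "0 < t" "t \<le> 1" for t
    proof -
      have "(\<lambda>n. (1 - t) * g (z n) + t * g ?w + t * (1 - t) * (norm (p n - y))\<^sup>2)
          \<longlonglongrightarrow> (1 - t) * M + t * g ?w + t * (1 - t) * (norm (q - y))\<^sup>2"
        by (intro tendsto_intros gz q)
      moreover have "(1 - t) * g (z n) + t * g ?w + t * (1 - t) * (norm (p n - y))\<^sup>2 \<le> M" for n
        using M_ub[OF conv[OF zK[of n] w, of t]] g_comb[of t "z n" ?w] t by (simp add: p_def)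
      ultimately have "(1 - t) * M + t * g ?w + t * (1 - t) * (norm (q - y))\<^sup>2 \<le> M"
        by (intro LIMSEQ_le_const2[of _ _ M]) auto
      then have "t * ((1 - t) * (norm (q - y))\<^sup>2) \<le> t * (M + (norm x)\<^sup>2)"
        by (simp add: gw algebra_simps)
      then show ?thesis using t by simp
    qed
    have "(\<lambda>n. (1 - inverse (real (Suc n))) * (norm (q - y))\<^sup>2) \<longlonglongrightarrow> (1 - 0) * (norm (q - y))\<^sup>2"
      by (intro tendsto_intros LIMSEQ_inverse_real_of_nat)
    then have "(1 - 0) * (norm (q - y))\<^sup>2 \<le> M + (norm x)\<^sup>2"
      by (rule LIMSEQ_le_const2) (use step in \<open>auto simp: inverse_le_1_iff\<close>)
    then have "(norm (q - y))\<^sup>2 \<le> M + (norm x)\<^sup>2" by (simp only: diff_zero mult_1)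
    then have "(norm (q - y))\<^sup>2 \<le> (norm x)\<^sup>2" using \<open>M \<le> 0\<close> by linarith
    then show ?thesis by (rule power2_le_imp_le) simp
  qed
  then show ?thesis by blast
qed auto

text \<open>
Kirszbraun's theorem. A partial Lipschitz map is a set of pairs, and it is automatically
single-valued; so unions of chains need no care and Zorn's lemma gives a maximal extension. It is
defined everywhere, since a missing value at \<open>x\<close> is provided by \<open>kirszbraun_point\<close> after moving
\<open>x\<close> to the origin and scaling by \<open>L\<close>.
\<close>

theorem kirszbraun:
  fixes R :: "('a::real_inner \<times> 'b::{real_inner,complete_space}) set"
  assumes "L \<ge> 0"
    and lip: "\<And>x y x' y'. (x, y) \<in> R \<Longrightarrow> (x', y') \<in> R \<Longrightarrow> norm (y - y') \<le> L * norm (x - x')"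
  obtains f where "L-lipschitz_on UNIV f" "\<And>x y. (x, y) \<in> R \<Longrightarrow> f x = y"
proof -
  let ?P = "\<lambda>S::('a \<times> 'b) set. \<forall>(x, y)\<in>S. \<forall>(x', y')\<in>S. norm (y - y') \<le> L * norm (x - x')"
  define \<A> where "\<A> = {S. R \<subseteq> S \<and> ?P S}"
  have "\<exists>S\<in>\<A>. \<forall>X\<in>\<A>. S \<subseteq> X \<longrightarrow> X = S"
  proof (rule subset_Zorn_nonempty)
    have "R \<in> \<A>" using lip by (auto simp: \<A>_def)
    then show "\<A> \<noteq> {}" by blast
    fix C assume "C \<noteq> {}" and ch: "subset.chain \<A> C"
    have "?P (\<Union>C)"
    proof (safe)
      fix x y x' y' A B assume *: "(x, y) \<in> A" "A \<in> C" "(x', y') \<in> B" "B \<in> C"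
      then have "A \<subseteq> B \<or> B \<subseteq> A" "A \<in> \<A>" "B \<in> \<A>" using ch by (auto simp: subset_chain_def)
      then show "norm (y - y') \<le> L * norm (x - x')" using * unfolding \<A>_def by blast
    qed
    moreover have "R \<subseteq> \<Union>C" using \<open>C \<noteq> {}\<close> ch unfolding subset_chain_def \<A>_def by blast
    ultimately show "\<Union>C \<in> \<A>" by (auto simp: \<A>_def)
  qed
  then obtain S where S: "R \<subseteq> S" "?P S" and max: "\<And>X. X \<in> \<A> \<Longrightarrow> S \<subseteq> X \<Longrightarrow> X = S"
    by (auto simp: \<A>_def)
  have "\<exists>y. (x, y) \<in> S" for x
  proof -
    have "\<exists>p. \<forall>(u, y) \<in> (\<lambda>(u, y). (L *\<^sub>R (u - x), y)) ` S. norm (p - y) \<le> norm u"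
    proof (rule kirszbraun_point)
      fix u y u' y'
      assume "(u, y) \<in> (\<lambda>(u, y). (L *\<^sub>R (u - x), y)) ` S" "(u', y') \<in> (\<lambda>(u, y). (L *\<^sub>R (u - x), y)) ` S"
      then obtain v v' where v: "(v, y) \<in> S" "(v', y') \<in> S" "u = L *\<^sub>R (v - x)" "u' = L *\<^sub>R (v' - x)"
        by auto
      have "u - u' = L *\<^sub>R (v - v')" by (simp add: v algebra_simps)
      then show "norm (y - y') \<le> norm (u - u')" using S(2) v(1,2) \<open>L \<ge> 0\<close> by auto
    qed
    then obtain p where p: "\<And>u y. (u, y) \<in> S \<Longrightarrow> norm (p - y) \<le> L * norm (u - x)"
      using \<open>L \<ge> 0\<close> by fastforce
    have "?P (insert (x, p) S)"
      using S(2) p by (auto simp: norm_minus_commute)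
    then have "insert (x, p) S \<in> \<A>" using S(1) by (auto simp: \<A>_def)
    then show ?thesis using max[of "insert (x, p) S"] by blast
  qed
  then obtain f where f: "\<And>x. (x, f x) \<in> S" by metis
  show ?thesis
  proof
    show "L-lipschitz_on UNIV f"
      using S(2) f \<open>L \<ge> 0\<close> by (intro lipschitz_onI) (fastforce simp: dist_norm)+
    show "f x = y" if "(x, y) \<in> R" for x y
    proof -
      have "norm (f x - y) \<le> L * norm (x - x)" using S f that by blast
      then show ?thesis by simp
    qed
  qed
qed

section \<open>Orthogonal projection onto a plane\<close>

text \<open>
Planes are handled through orthonormal frames because frames are points of the metric space
\<open>nat \<Rightarrow> 'a\<close>, where separability yields countable dense families. Values at indices \<open>\<ge> m\<close> are
arbitrary.
\<close>

definition orthonormal_frame :: "nat \<Rightarrow> (nat \<Rightarrow> 'a::real_inner) \<Rightarrow> bool" where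
  "orthonormal_frame m b \<longleftrightarrow> (\<forall>i<m. \<forall>j<m. b i \<bullet> b j = (if i = j then 1 else 0))"

text \<open>
For an orthonormal frame this is the orthogonal projection onto its span, which is how planes in a
space of infinite dimension get a continuous projection.
\<close>

definition frame_proj :: "nat \<Rightarrow> (nat \<Rightarrow> 'a::real_inner) \<Rightarrow> 'a \<Rightarrow> 'a" where
  "frame_proj m b x = (\<Sum>i<m. (x \<bullet> b i) *\<^sub>R b i)"

abbreviation frame_span :: "nat \<Rightarrow> (nat \<Rightarrow> 'a::real_inner) \<Rightarrow> 'a set" where
  "frame_span m b \<equiv> span (b ` {..<m})"

lemma orthonormal_frameD: "orthonormal_frame m b \<Longrightarrow> i < m \<Longrightarrow> j < m \<Longrightarrow> b i \<bullet> b j = (if i = j then 1 else 0)"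
  by (simp add: orthonormal_frame_def)

lemma bounded_linear_frame_proj: "bounded_linear (frame_proj m b)"
  unfolding frame_proj_def
  by (intro bounded_linear_sum bounded_linear_compose[OF bounded_linear_scaleR_left] bounded_linear_inner_left)

lemmas frame_proj_diff = linear_diff[OF bounded_linear.linear[OF bounded_linear_frame_proj]]

lemma frame_proj_in_span: "frame_proj m b x \<in> frame_span m b"
  unfolding frame_proj_def by (intro span_sum span_scale span_base) auto

lemma orthogonal_complement_span_inner: "u \<in> V\<^sup>\<bottom> \<Longrightarrow> v \<in> V \<Longrightarrow> v \<bullet> u = 0"
  by (simp add: orthogonal_comp_def orthogonal_def)

lemma minus_frame_proj_orthogonal:
  assumes "orthonormal_frame m b"
  shows "x - frame_proj m b x \<in> (frame_span m b)\<^sup>\<bottom>"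
proof -
  have "(x - frame_proj m b x) \<bullet> b j = 0" if "j < m" for j
  proof -
    have "frame_proj m b x \<bullet> b j = (\<Sum>i<m. (x \<bullet> b i) * (b i \<bullet> b j))"
      by (simp add: frame_proj_def inner_sum_left)
    also have "\<dots> = (\<Sum>i<m. if i = j then x \<bullet> b i else 0)"
      by (rule sum.cong) (use that orthonormal_frameD[OF assms] in auto)
    also have "\<dots> = x \<bullet> b j" using that by simp
    finally show ?thesis by (simp add: inner_diff_left)
  qed
  then have "orthogonal (x - frame_proj m b x) y" if "y \<in> frame_span m b" for y
    using orthogonal_to_span[OF that] by (force simp: orthogonal_def)
  then show ?thesis by (simp add: orthogonal_comp_def orthogonal_commute)
qed

lemma norm_add_orthogonal:
  assumes "v \<in> V" "u \<in> V\<^sup>\<bottom>"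
  shows "(norm (v + u))\<^sup>2 = (norm v)\<^sup>2 + (norm u)\<^sup>2"
  using orthogonal_complement_span_inner[OF assms(2,1)] by (simp add: norm_add_Pythagorean orthogonal_def)

lemma frame_proj_unique:
  assumes b: "orthonormal_frame m b" and "v \<in> frame_span m b" "u \<in> (frame_span m b)\<^sup>\<bottom>"
  shows "frame_proj m b (v + u) = v"
proof -
  let ?V = "frame_span m b" and ?p = "frame_proj m b (v + u)"
  have "?p - v \<in> ?V" using assms frame_proj_in_span by (intro span_diff) auto
  moreover have "u - (v + u - ?p) \<in> ?V\<^sup>\<bottom>"
    by (rule subspace_diff[OF subspace_orthogonal_comp assms(3) minus_frame_proj_orthogonal[OF b]])
  ultimately have "(?p - v) \<bullet> (?p - v) = 0"
    by (metis add.commute add_diff_cancel_right' diff_add_eq diff_diff_eq2 orthogonal_complement_span_inner)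
  then show ?thesis by simp
qed

lemma norm_frame_proj_Pythagoras:
  assumes "orthonormal_frame m b"
  shows "(norm x)\<^sup>2 = (norm (frame_proj m b x))\<^sup>2 + (norm (x - frame_proj m b x))\<^sup>2"
  using norm_add_orthogonal[OF frame_proj_in_span minus_frame_proj_orthogonal[OF assms], of x x] by simp

lemma infdist_frame_span:
  assumes b: "orthonormal_frame m b"
  shows "infdist x (frame_span m b) = norm (x - frame_proj m b x)"
proof (rule antisym)
  show "infdist x (frame_span m b) \<le> norm (x - frame_proj m b x)"
    using infdist_le[OF frame_proj_in_span] by (simp add: dist_norm)
  have "norm (x - frame_proj m b x) \<le> dist x v" if "v \<in> frame_span m b" for v
  proof -
    have "(norm (frame_proj m b x - v + (x - frame_proj m b x)))\<^sup>2
        = (norm (frame_proj m b x - v))\<^sup>2 + (norm (x - frame_proj m b x))\<^sup>2"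
      using that by (intro norm_add_orthogonal[where V = "frame_span m b"] span_diff
          frame_proj_in_span minus_frame_proj_orthogonal[OF b])
    then have "(norm (x - frame_proj m b x))\<^sup>2 \<le> (dist x v)\<^sup>2" by (simp add: dist_norm)
    then show ?thesis by (rule power2_le_imp_le) simp
  qed
  moreover have "frame_span m b \<noteq> {}" using span_zero by blast
  ultimately show "norm (x - frame_proj m b x) \<le> infdist x (frame_span m b)"
    unfolding infdist_def by (auto intro!: cINF_greatest)
qed

lemma m_plane_frame_span:
  assumes b: "orthonormal_frame m b"
  shows "m_plane m (frame_span m b)"
proof -
  have inj: "inj_on b {..<m}"
    using orthonormal_frameD[OF b] by (intro inj_onI) (metis lessThan_iff zero_neq_one)
  have "independent (b ` {..<m})"
  proof (rule pairwise_orthogonal_independent)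
    show "pairwise orthogonal (b ` {..<m})"
      using orthonormal_frameD[OF b] by (auto simp: pairwise_def orthogonal_def)
    show "0 \<notin> b ` {..<m}"
      using orthonormal_frameD[OF b] by (metis imageE inner_zero_left lessThan_iff zero_neq_one)
  qed
  then have "dim (frame_span m b) = m"
    using inj by (simp add: dim_eq_card_independent card_image)
  then show ?thesis by (auto simp: m_plane_def)
qed

text \<open>
Gram-Schmidt on a finite spanning set; the vectors equal to zero are discarded before normalising, and
the number of the others is the dimension because they are independent.
\<close>

lemma m_plane_obtain_frame:
  assumes "m_plane m V"
  obtains b where "orthonormal_frame m b" "V = frame_span m b"
proof -
  obtain B where B: "finite B" "span B = V" and dimV: "dim V = m"
    using assms by (auto simp: m_plane_def)
  obtain C where C: "finite C" "span C = V" "pairwise orthogonal C"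
    using basis_orthogonal[OF B(1)] B(2) by auto
  define D where "D = C - {0}"
  have D: "finite D" "span D = V" "pairwise orthogonal D" "0 \<notin> D"
    using C by (auto simp: D_def pairwise_def span_delete_0)
  then have "card D = m"
    using pairwise_orthogonal_independent dim_span_eq_card_independent dimV by metis
  then obtain c where c: "bij_betw c {..<m} D"
    using ex_bij_betw_nat_finite[OF D(1)] by (auto simp: atLeast0LessThan)
  define b where "b i = c i /\<^sub>R norm (c i)" for i
  have cD: "c i \<in> D" if "i < m" for i using c that by (auto simp: bij_betw_def)
  then have c0: "c i \<noteq> 0" if "i < m" for i using D(4) that by metis
  have "b i \<bullet> b j = (if i = j then 1 else 0)" if "i < m" "j < m" for i j
  proof (cases "i = j")
    case True
    then show ?thesis using c0[OF that(1)]
      by (simp add: b_def power2_norm_eq_inner[symmetric] power2_eq_square)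
  next
    case False
    then have "c i \<noteq> c j" using c that by (auto simp: bij_betw_def inj_on_def)
    then have "c i \<bullet> c j = 0" using D(3) cD that by (auto simp: pairwise_def orthogonal_def)
    then show ?thesis using False by (simp add: b_def)
  qed
  then have "orthonormal_frame m b" by (simp add: orthonormal_frame_def)
  moreover have "frame_span m b = V"
  proof -
    have "frame_span m b \<subseteq> V"
    proof (rule span_minimal)
      show "b ` {..<m} \<subseteq> V"
      proof
        fix v assume "v \<in> b ` {..<m}"
        then obtain i where "i < m" "v = c i /\<^sub>R norm (c i)" by (auto simp: b_def)
        then show "v \<in> V" using span_scale[OF span_base[OF cD]] D(2) by blast
      qed
      show "subspace V" using D(2) subspace_span by blast
    qed
    moreover have "D \<subseteq> frame_span m b"
    proof
      fix d assume "d \<in> D"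
      then obtain i where i: "i < m" "d = c i" using c by (auto simp: bij_betw_def)
      then have "d = norm (c i) *\<^sub>R b i" using c0 by (simp add: b_def)
      moreover have "b i \<in> frame_span m b" using i(1) by (intro span_base) auto
      ultimately show "d \<in> frame_span m b" using span_scale by metis
    qed
    ultimately show ?thesis using D(2) span_minimal subspace_span by blast
  qed
  ultimately show ?thesis using that by metis
qed

section \<open>Lipschitz graphs and cones\<close>

lemma good_cone_frame_span:
  assumes "orthonormal_frame m b"
  shows "y \<in> good_cone x (frame_span m b) \<alpha> \<longleftrightarrow>
    norm ((y - x) - frame_proj m b (y - x)) \<le> \<alpha> * norm (y - x)"
  by (simp add: good_cone_def infdist_frame_span[OF assms] norm_minus_commute)

lemma closed_good_cone: "closed (good_cone x V \<alpha>)"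
  unfolding good_cone_def
  by (intro closed_Collect_le continuous_on_infdist continuous_intros)

lemma bad_cone_ball_borel: "bad_cone_ball x r V \<alpha> \<in> sets borel"
  unfolding bad_cone_ball_def bad_cone_def
  using borel_closed[OF closed_good_cone] by (intro sets.Int sets.Diff) auto

text \<open>
With \<open>P\<close> the projection onto the plane, the graph is the solution set of \<open>x - P x = f (P x)\<close>, and
both sides are continuous. Without this, the exceptional set of a family of graphs might fail to be
measurable, and its measure would then be \<open>0\<close> by convention only.
\<close>

lemma lipschitz_graph_closed:
  fixes \<Gamma> :: "'a::real_inner set"
  assumes "lipschitz_graph m L \<Gamma>"
  shows "closed \<Gamma>"
proof -
  obtain V f where V: "m_plane m V" and f: "f ` V \<subseteq> V\<^sup>\<bottom>" "L-lipschitz_on V f"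
    and \<Gamma>: "\<Gamma> = (\<lambda>v. v + f v) ` V"
    using assms by (auto simp: lipschitz_graph_def)
  obtain b where b: "orthonormal_frame m b" "V = frame_span m b"
    using m_plane_obtain_frame[OF V] .
  let ?P = "frame_proj m b"
  have "\<Gamma> = {x. x - ?P x = f (?P x)}"
  proof (intro set_eqI iffI)
    fix x assume "x \<in> \<Gamma>"
    then obtain v where v: "v \<in> V" "x = v + f v" by (auto simp: \<Gamma>)
    then have "?P x = v" using frame_proj_unique[OF b(1)] f(1) b(2) by blast
    then show "x \<in> {x. x - ?P x = f (?P x)}" using v by simp
  next
    fix x assume "x \<in> {x. x - ?P x = f (?P x)}"
    then have "x = ?P x + f (?P x)" by (simp add: algebra_simps)
    then show "x \<in> \<Gamma>" unfolding \<Gamma> using frame_proj_in_span b(2) by blast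
  qed
  moreover have "continuous_on UNIV ?P"
    by (intro linear_continuous_on bounded_linear_frame_proj)
  moreover have "continuous_on UNIV (\<lambda>x. f (?P x))"
    using lipschitz_on_continuous_on[OF f(2)] \<open>continuous_on UNIV ?P\<close>
    by (rule continuous_on_compose2) (use frame_proj_in_span b(2) in blast)
  ultimately show ?thesis by (auto intro!: closed_Collect_eq continuous_intros)
qed

text \<open>
A difference \<open>z\<close> of two points of the graph satisfies \<open>\<bar>z - P z\<bar> \<le> M \<bar>P z\<bar>\<close>, which by Pythagoras is
\<open>\<bar>z - P z\<bar> \<le> \<alpha> \<bar>z\<bar>\<close> with \<open>\<alpha> = M / sqrt (1 + M\<^sup>2)\<close>. Taking \<open>M = L + 1\<close> instead of \<open>L\<close> makes \<open>\<alpha>\<close>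
positive also when \<open>L = 0\<close>.
\<close>

lemma lipschitz_graph_in_good_cones:
  fixes \<Gamma> :: "'a::real_inner set"
  assumes "lipschitz_graph m L \<Gamma>"
  obtains V \<alpha> where "m_plane m V" "0 < \<alpha>" "\<alpha> < 1" "\<And>x. x \<in> \<Gamma> \<Longrightarrow> \<Gamma> \<subseteq> good_cone x V \<alpha>"
proof -
  obtain V f where V: "m_plane m V" and f: "f ` V \<subseteq> V\<^sup>\<bottom>" "L-lipschitz_on V f"
    and \<Gamma>: "\<Gamma> = (\<lambda>v. v + f v) ` V"
    using assms by (auto simp: lipschitz_graph_def)
  obtain b where b: "orthonormal_frame m b" "V = frame_span m b"
    using m_plane_obtain_frame[OF V] .
  let ?P = "frame_proj m b"
  define M where "M = L + 1"
  have "M > 0" using lipschitz_on_nonneg[OF f(2)] by (simp add: M_def)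
  define \<alpha> where "\<alpha> = sqrt (M\<^sup>2 / (1 + M\<^sup>2))"
  have "M\<^sup>2 > 0" using \<open>M > 0\<close> by simp
  then have \<alpha>: "0 < \<alpha>" "\<alpha> < 1" by (auto simp: \<alpha>_def real_sqrt_lt_1_iff add_pos_pos)
  have "y \<in> good_cone x V \<alpha>" if "x \<in> \<Gamma>" "y \<in> \<Gamma>" for x y
  proof -
    obtain v w where v: "v \<in> V" "x = v + f v" and w: "w \<in> V" "y = w + f w"
      using \<open>x \<in> \<Gamma>\<close> \<open>y \<in> \<Gamma>\<close> unfolding \<Gamma> by blast
    let ?z = "y - x" and ?q = "norm ((y - x) - ?P (y - x))"
    have "f w - f v \<in> V\<^sup>\<bottom>"
      using f(1) v w by (intro subspace_diff subspace_orthogonal_comp) auto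
    moreover have "w - v \<in> frame_span m b" using v w b(2) by (auto intro: span_diff)
    moreover have z: "?z = (w - v) + (f w - f v)" by (simp add: v w)
    ultimately have P: "?P ?z = w - v"
      using frame_proj_unique[OF b(1), of "w - v" "f w - f v"] b(2) by metis
    then have q: "?z - ?P ?z = f w - f v" using z by simp
    have "?q \<le> L * norm (?P ?z)"
      using lipschitz_onD[OF f(2) w(1) v(1)] unfolding q unfolding P by (simp add: dist_norm)
    also have "\<dots> \<le> M * norm (?P ?z)" by (simp add: M_def mult_right_mono)
    finally have "?q\<^sup>2 \<le> (M * norm (?P ?z))\<^sup>2" by (intro power_mono) auto
    then have "?q\<^sup>2 \<le> M\<^sup>2 * ((norm ?z)\<^sup>2 - ?q\<^sup>2)"
      using norm_frame_proj_Pythagoras[OF b(1), of ?z] by (simp add: power_mult_distrib)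
    then have "?q\<^sup>2 * (1 + M\<^sup>2) \<le> M\<^sup>2 * (norm ?z)\<^sup>2" by (simp add: algebra_simps)
    moreover have "1 + M\<^sup>2 > 0" using \<open>M\<^sup>2 > 0\<close> by linarith
    ultimately have "?q\<^sup>2 \<le> M\<^sup>2 / (1 + M\<^sup>2) * (norm ?z)\<^sup>2"
      by (simp only: times_divide_eq_left pos_le_divide_eq)
    also have "\<dots> = (\<alpha> * norm ?z)\<^sup>2"
      by (simp add: \<alpha>_def power_mult_distrib)
    finally have "?q \<le> \<alpha> * norm ?z" by (rule power2_le_imp_le) (use \<alpha> in simp)
    then show ?thesis using good_cone_frame_span[OF b(1)] b(2) by simp
  qed
  then show ?thesis using that V \<alpha> by blast
qed

text \<open>
Conversely, the cone condition bounds \<open>x - P x\<close> by \<open>P x\<close> on differences, so \<open>P x \<mapsto> x - P x\<close> is a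
Lipschitz map on the projection of \<open>S\<close>. It takes values in a space that may have infinite
dimension, so that extending it coordinate by coordinate would lose the Lipschitz constant; this is
where Kirszbraun's theorem is needed.
\<close>

lemma good_cone_condition_imp_graph:
  fixes S :: "'a::{real_inner, complete_space} set"
  assumes b: "orthonormal_frame m b" and \<beta>: "0 \<le> \<beta>" "\<beta> < 1"
    and cone: "\<And>x y. x \<in> S \<Longrightarrow> y \<in> S \<Longrightarrow> y \<in> good_cone x (frame_span m b) \<beta>"
  shows "\<exists>L \<Gamma>. lipschitz_graph m L \<Gamma> \<and> S \<subseteq> \<Gamma>"
proof -
  let ?V = "frame_span m b" and ?P = "frame_proj m b"
  let ?Q = "\<lambda>x. x - ?P x"
  define L where "L = sqrt (\<beta>\<^sup>2 / (1 - \<beta>\<^sup>2))"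
  have \<beta>1: "\<beta>\<^sup>2 < 1" using \<beta> by (simp add: power_less_one_iff)
  then have "L \<ge> 0" by (simp add: L_def)
  have Q_le: "norm (?Q x - ?Q y) \<le> L * norm (?P x - ?P y)" if "x \<in> S" "y \<in> S" for x y
  proof -
    let ?z = "x - y"
    have "norm (?Q ?z) \<le> \<beta> * norm ?z"
      using cone[OF that(2,1)] good_cone_frame_span[OF b] by blast
    then have "(norm (?Q ?z))\<^sup>2 \<le> (\<beta> * norm ?z)\<^sup>2" by (intro power_mono) auto
    also have "\<dots> = \<beta>\<^sup>2 * ((norm (?P ?z))\<^sup>2 + (norm (?Q ?z))\<^sup>2)"
      using norm_frame_proj_Pythagoras[OF b, of ?z] by (simp add: power_mult_distrib)
    finally have "(norm (?Q ?z))\<^sup>2 \<le> \<beta>\<^sup>2 / (1 - \<beta>\<^sup>2) * (norm (?P ?z))\<^sup>2"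
      using \<beta>1 by (simp add: field_simps)
    also have "\<dots> = (L * norm (?P ?z))\<^sup>2" using \<beta>1 by (simp add: L_def power_mult_distrib)
    finally have "norm (?Q ?z) \<le> L * norm (?P ?z)"
      by (rule power2_le_imp_le) (use \<open>L \<ge> 0\<close> in simp)
    moreover have "?Q ?z = ?Q x - ?Q y" "?P ?z = ?P x - ?P y" by (simp_all add: frame_proj_diff)
    ultimately show ?thesis by (simp only:)
  qed
  obtain g where g: "L-lipschitz_on UNIV g" and gR: "\<And>x y. (x, y) \<in> (\<lambda>x. (?P x, ?Q x)) ` S \<Longrightarrow> g x = y"
    by (rule kirszbraun[OF \<open>L \<ge> 0\<close>, of "(\<lambda>x. (?P x, ?Q x)) ` S"]) (use Q_le in auto)
  \<comment> \<open>The extension need not take values in the orthogonal complement; projecting there keeps the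
    constant and the prescribed values.\<close>
  define f where "f v = ?Q (g v)" for v
  have "L-lipschitz_on ?V f"
  proof (rule lipschitz_onI)
    fix v w
    have "(norm (?Q (g v - g w)))\<^sup>2 \<le> (norm (g v - g w))\<^sup>2"
      using norm_frame_proj_Pythagoras[OF b, of "g v - g w"] by simp
    then have "norm (?Q (g v - g w)) \<le> norm (g v - g w)" by (rule power2_le_imp_le) simp
    moreover have "f v - f w = ?Q (g v - g w)" by (simp add: f_def frame_proj_diff)
    moreover have "norm (g v - g w) \<le> L * dist v w"
      using lipschitz_onD[OF g, of v w] by (simp add: dist_norm)
    ultimately show "dist (f v) (f w) \<le> L * dist v w" by (simp add: dist_norm)
  qed (fact \<open>L \<ge> 0\<close>)
  moreover have "f ` ?V \<subseteq> ?V\<^sup>\<bottom>"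
    using minus_frame_proj_orthogonal[OF b] by (auto simp: f_def)
  ultimately have "lipschitz_graph m L ((\<lambda>v. v + f v) ` ?V)"
    using m_plane_frame_span[OF b] unfolding lipschitz_graph_def by blast
  moreover have "S \<subseteq> (\<lambda>v. v + f v) ` ?V"
  proof
    fix x assume "x \<in> S"
    then have "g (?P x) = ?Q x" using gR by blast
    moreover have "?P (?Q x) = 0"
      using frame_proj_unique[OF b span_zero minus_frame_proj_orthogonal[OF b]] by simp
    ultimately have "x = ?P x + f (?P x)" by (simp add: f_def)
    then show "x \<in> (\<lambda>v. v + f v) ` ?V" using frame_proj_in_span by blast
  qed
  ultimately show ?thesis by blast
qed

section \<open>Countably many planes suffice\<close>

text \<open>
The point of the second plane that has the same coordinates as the projection of \<open>y - x\<close> is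
close to that projection, the error being at most \<open>\<eta> \<bar>y - x\<bar>\<close> for each of the \<open>m\<close> coordinates.
\<close>

lemma good_cone_perturb:
  assumes b: "orthonormal_frame m b" and close: "\<And>i. i < m \<Longrightarrow> norm (b i - c i) \<le> \<eta>"
  shows "good_cone x (frame_span m b) \<alpha> \<subseteq> good_cone x (frame_span m c) (\<alpha> + m * \<eta>)"
proof
  fix y assume y: "y \<in> good_cone x (frame_span m b) \<alpha>"
  let ?z = "y - x"
  let ?w = "\<Sum>i<m. (?z \<bullet> b i) *\<^sub>R c i"
  have "?w \<in> frame_span m c" by (intro span_sum span_scale span_base) auto
  then have "infdist ?z (frame_span m c) \<le> norm (?z - ?w)"
    using infdist_le by (metis dist_norm)
  also have "?z - ?w = (?z - frame_proj m b ?z) + (\<Sum>i<m. (?z \<bullet> b i) *\<^sub>R (b i - c i))"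
    by (simp add: frame_proj_def scaleR_diff_right sum_subtractf)
  also have "norm \<dots> \<le> \<alpha> * norm ?z + (\<Sum>i<m. norm ?z * \<eta>)"
  proof (rule norm_triangle_mono)
    show "norm (?z - frame_proj m b ?z) \<le> \<alpha> * norm ?z"
      using y good_cone_frame_span[OF b] by blast
    show "norm (\<Sum>i<m. (?z \<bullet> b i) *\<^sub>R (b i - c i)) \<le> (\<Sum>i<m. norm ?z * \<eta>)"
    proof (rule sum_norm_le)
      fix i assume "i \<in> {..<m}"
      then have i: "i < m" by simp
      have "norm (b i) = 1" using orthonormal_frameD[OF b i i] by (simp add: norm_eq_1)
      then have "\<bar>?z \<bullet> b i\<bar> \<le> norm ?z" using Cauchy_Schwarz_ineq2[of ?z "b i"] by simp
      then show "norm ((?z \<bullet> b i) *\<^sub>R (b i - c i)) \<le> norm ?z * \<eta>"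
        using close[OF i] by (auto intro!: mult_mono)
    qed
  qed
  finally show "y \<in> good_cone x (frame_span m c) (\<alpha> + m * \<eta>)"
    by (simp add: good_cone_def norm_minus_commute algebra_simps)
qed

text \<open>
A subset of a separable metric space is separable, so the dense family can be taken inside the set
of orthonormal frames; closeness in \<open>nat \<Rightarrow> 'a\<close> controls any finite number of coordinates.
\<close>

lemma countable_dense_frames:
  obtains T :: "(nat \<Rightarrow> 'a::{real_inner, second_countable_topology}) set"
  where "countable T" "\<And>b. b \<in> T \<Longrightarrow> orthonormal_frame m b"
    "\<And>b \<eta>. orthonormal_frame m b \<Longrightarrow> \<eta> > 0 \<Longrightarrow> \<exists>c\<in>T. \<forall>i<m. norm (b i - c i) < \<eta>"
proof -
  let ?S = "{b :: nat \<Rightarrow> 'a. orthonormal_frame m b}"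
  obtain T where T: "countable T" "T \<subseteq> ?S" "?S \<subseteq> closure T" by (rule separable)
  have "\<exists>c\<in>T. \<forall>i<m. norm (b i - c i) < \<eta>" if b: "orthonormal_frame m b" and "\<eta> > 0" for b and \<eta> :: real
  proof -
    let ?U = "{c. \<forall>i\<in>{..<m}. norm (b i - c i) < \<eta>}"
    have "open {c :: nat \<Rightarrow> 'a. norm (b i - c i) < \<eta>}" for i
      by (intro open_Collect_less continuous_intros continuous_on_product_coordinates)
    then have "open (\<Inter>i\<in>{..<m}. {c. norm (b i - c i) < \<eta>})" by (intro open_INT) auto
    moreover have "(\<Inter>i\<in>{..<m}. {c. norm (b i - c i) < \<eta>}) = ?U" by blast
    ultimately have "open ?U" by simp
    moreover have "b \<in> ?U" using \<open>\<eta> > 0\<close> by simp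
    moreover have "b \<in> closure T" using T(3) b by blast
    ultimately have "?U \<inter> T \<noteq> {}" using open_Int_closure_eq_empty by blast
    then show ?thesis by auto
  qed
  then show ?thesis using that T by blast
qed

section \<open>Balls of a pointwise doubling measure\<close>

lemma pointwise_doubling_sets: "pointwise_doubling \<mu> \<Longrightarrow> sets \<mu> = sets borel"
  by (simp add: pointwise_doubling_def)

lemma pointwise_doubling_fmeasurable:
  assumes "pointwise_doubling \<mu>" "A \<in> sets borel" "bounded A"
  shows "A \<in> fmeasurable \<mu>"
  using assms by (auto simp: pointwise_doubling_def fmeasurable_def)

lemma cball_fmeasurable: "pointwise_doubling \<mu> \<Longrightarrow> cball x r \<in> fmeasurable \<mu>"
  by (rule pointwise_doubling_fmeasurable) auto

lemma subset_cball_fmeasurable: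
  "pointwise_doubling \<mu> \<Longrightarrow> A \<in> sets borel \<Longrightarrow> A \<subseteq> cball x r \<Longrightarrow> A \<in> fmeasurable \<mu>"
  using pointwise_doubling_fmeasurable bounded_subset[OF bounded_cball] by blast

lemma measure_mono_cball:
  "pointwise_doubling \<mu> \<Longrightarrow> A \<in> sets borel \<Longrightarrow> B \<in> sets borel \<Longrightarrow> A \<subseteq> B \<Longrightarrow> B \<subseteq> cball x r
    \<Longrightarrow> measure \<mu> A \<le> measure \<mu> B"
  by (rule measure_mono_fmeasurable)
    (auto simp: pointwise_doubling_sets intro: subset_cball_fmeasurable)

text \<open>
Doubling with an explicit constant on an explicit range of radii. Positivity is included so that
quotients of measures may be cleared of denominators. Integer constants and, later, radii
\<open>1 / (j + 1)\<close> leave countably many cases.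
\<close>

definition doubling_at :: "'a::{real_inner, polish_space} measure \<Rightarrow> nat \<Rightarrow> real \<Rightarrow> 'a \<Rightarrow> bool" where
  "doubling_at \<mu> K \<delta> x \<longleftrightarrow> (\<forall>r. 0 < r \<and> r \<le> \<delta> \<longrightarrow>
     0 < measure \<mu> (cball x r) \<and> measure \<mu> (cball x (2 * r)) \<le> real K * measure \<mu> (cball x r))"

lemma doubling_atD:
  assumes "doubling_at \<mu> K \<delta> x" "0 < r" "r \<le> \<delta>"
  shows "0 < measure \<mu> (cball x r)" "measure \<mu> (cball x (2 * r)) \<le> real K * measure \<mu> (cball x r)"
  using assms by (auto simp: doubling_at_def)

lemma doubling_at_mono: "doubling_at \<mu> K \<delta> x \<Longrightarrow> \<delta>' \<le> \<delta> \<Longrightarrow> doubling_at \<mu> K \<delta>' x"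
  by (auto simp: doubling_at_def)

lemma doubling_at_iterate:
  assumes "doubling_at \<mu> K \<delta> x" "0 < r" "r \<le> 2 * \<delta>"
  shows "measure \<mu> (cball x r) \<le> real K ^ p * measure \<mu> (cball x (r / 2 ^ p))"
proof (induction p)
  case (Suc p)
  have "r / 2 ^ Suc p \<le> r / 2"
    using assms(2) by (intro divide_left_mono) auto
  then have "measure \<mu> (cball x (2 * (r / 2 ^ Suc p))) \<le> real K * measure \<mu> (cball x (r / 2 ^ Suc p))"
    using assms by (intro doubling_atD(2)) auto
  then have "real K ^ p * measure \<mu> (cball x (r / 2 ^ p))
      \<le> real K ^ p * (real K * measure \<mu> (cball x (r / 2 ^ Suc p)))"
    by (intro mult_left_mono) auto
  with Suc show ?case by (simp add: mult_ac)
qed simp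

text \<open>
The complement of the support is a union of null sets taken from a countable base.
\<close>

lemma AE_cball_pos:
  fixes \<mu> :: "'a::{metric_space, second_countable_topology} measure"
  assumes "sets \<mu> = sets borel"
  shows "AE x in \<mu>. \<forall>r>0. emeasure \<mu> (cball x r) > 0"
proof -
  obtain \<B> :: "'a set set" where \<B>: "countable \<B>" "topological_basis \<B>"
    using ex_countable_basis by auto
  have opn: "U \<in> sets \<mu>" if "U \<in> \<B>" for U
    using topological_basis_open[OF \<B>(2) that] assms by simp
  have "(\<Union>U\<in>{U\<in>\<B>. emeasure \<mu> U = 0}. U) \<in> null_sets \<mu>"
    using \<B>(1) opn by (intro null_sets_UN') auto
  then show ?thesis
  proof (rule AE_I')
    show "{x \<in> space \<mu>. \<not> (\<forall>r>0. emeasure \<mu> (cball x r) > 0)} \<subseteq> (\<Union>U\<in>{U\<in>\<B>. emeasure \<mu> U = 0}. U)"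
    proof
      fix x assume "x \<in> {x \<in> space \<mu>. \<not> (\<forall>r>0. emeasure \<mu> (cball x r) > 0)}"
      then obtain r where r: "r > 0" "emeasure \<mu> (cball x r) = 0" by auto
      obtain U where U: "U \<in> \<B>" "x \<in> U" "U \<subseteq> ball x r"
        using topological_basisE[OF \<B>(2) open_ball, of x x r] r(1) by auto
      have "emeasure \<mu> U \<le> emeasure \<mu> (cball x r)"
        using U(3) ball_subset_cball assms by (intro emeasure_mono) auto
      then show "x \<in> (\<Union>U\<in>{U\<in>\<B>. emeasure \<mu> U = 0}. U)" using U r by auto
    qed
  qed
qed

lemma eventually_at_right_0_Suc:
  assumes "eventually P (at_right (0::real))"
  obtains j where "\<And>r. 0 < r \<Longrightarrow> r \<le> 1 / real (Suc j) \<Longrightarrow> P r"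
proof -
  obtain b where b: "b > 0" "\<And>y. 0 < y \<Longrightarrow> y < b \<Longrightarrow> P y"
    using assms by (auto simp: eventually_at_right_field)
  obtain j where "1 / real (Suc j) < b" using b(1) nat_approx_posE by blast
  then show ?thesis using that[of j] b(2) by force
qed

lemma AE_doubling_at:
  assumes "pointwise_doubling \<mu>"
  shows "AE x in \<mu>. \<exists>K j. doubling_at \<mu> K (1 / real (Suc j)) x"
proof -
  have "AE x in \<mu>. Limsup (at_right 0)
      (\<lambda>r::real. emeasure \<mu> (cball x (2 * r)) / emeasure \<mu> (cball x r)) < \<infinity>"
    using assms by (simp add: pointwise_doubling_def)
  moreover have "AE x in \<mu>. \<forall>r>0. emeasure \<mu> (cball x r) > 0"
    by (rule AE_cball_pos[OF pointwise_doubling_sets[OF assms]])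
  ultimately show ?thesis
  proof eventually_elim
    case (elim x)
    obtain K :: nat where "Limsup (at_right 0)
        (\<lambda>r::real. emeasure \<mu> (cball x (2 * r)) / emeasure \<mu> (cball x r)) < of_nat K"
      using ennreal_Ex_less_of_nat elim(1) by (metis infinity_ennreal_def)
    from Limsup_lessD[OF this] obtain j where
      j: "\<And>r. 0 < r \<Longrightarrow> r \<le> 1 / real (Suc j) \<Longrightarrow>
          emeasure \<mu> (cball x (2 * r)) / emeasure \<mu> (cball x r) < of_nat K"
      using eventually_at_right_0_Suc by blast
    have "doubling_at \<mu> K (1 / real (Suc j)) x"
      unfolding doubling_at_def
    proof (intro allI impI)
      fix r assume r: "0 < r \<and> r \<le> 1 / real (Suc j)"
      have em: "emeasure \<mu> (cball x s) = ennreal (measure \<mu> (cball x s))" for s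
        using cball_fmeasurable[OF assms] by (intro emeasure_eq_measure2)
      have pos: "0 < measure \<mu> (cball x r)" using elim(2) r em[of r] by (metis ennreal_0 less_irrefl zero_less_measure_iff)
      have "ennreal (measure \<mu> (cball x (2 * r)) / measure \<mu> (cball x r)) < ennreal (real K)"
        using j[of r] r pos by (simp add: em divide_ennreal ennreal_of_nat_eq_real_of_nat)
      then have "measure \<mu> (cball x (2 * r)) / measure \<mu> (cball x r) < real K"
        by (simp add: ennreal_less_iff)
      then show "0 < measure \<mu> (cball x r) \<and> measure \<mu> (cball x (2 * r)) \<le> real K * measure \<mu> (cball x r)"
        using pos by (simp add: field_simps)
    qed
    then show ?case by blast
  qed
qed

text \<open>
Where balls have positive measure, the limit of quotients in \<open>ennreal\<close> can be replaced by real
inequalities without division.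
\<close>

lemma cball_ratio_tendsto_0_iff:
  assumes \<mu>: "pointwise_doubling \<mu>" and x: "doubling_at \<mu> K \<delta> x" "\<delta> > 0"
    and A: "\<And>r. A r \<in> sets borel" "\<And>r. A r \<subseteq> cball x r"
  shows "((\<lambda>r. emeasure \<mu> (A r) / emeasure \<mu> (cball x r)) \<longlongrightarrow> 0) (at_right 0) \<longleftrightarrow>
    (\<forall>\<epsilon>>0. \<forall>\<^sub>F r in at_right 0. measure \<mu> (A r) \<le> \<epsilon> * measure \<mu> (cball x r))"
proof -
  let ?q = "\<lambda>r. measure \<mu> (A r) / measure \<mu> (cball x r)"
  have "\<forall>\<^sub>F r in at_right 0. (0::real) < r \<and> r \<le> \<delta>"
    using eventually_at_right_less[of 0] eventually_at_right_real[OF \<open>\<delta> > 0\<close>]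
    by eventually_elim auto
  then have pos: "\<forall>\<^sub>F r in at_right 0. 0 < measure \<mu> (cball x r)"
    by eventually_elim (use doubling_atD(1)[OF x(1)] in blast)
  then have "\<forall>\<^sub>F r in at_right 0. emeasure \<mu> (A r) / emeasure \<mu> (cball x r) = ennreal (?q r)"
  proof eventually_elim
    case (elim r)
    have "emeasure \<mu> (A r) = ennreal (measure \<mu> (A r))"
      by (intro emeasure_eq_measure2 subset_cball_fmeasurable[OF \<mu> A])
    moreover have "emeasure \<mu> (cball x r) = ennreal (measure \<mu> (cball x r))"
      by (intro emeasure_eq_measure2 cball_fmeasurable[OF \<mu>])
    ultimately show ?case using elim by (simp add: divide_ennreal)
  qed
  then have "((\<lambda>r. emeasure \<mu> (A r) / emeasure \<mu> (cball x r)) \<longlongrightarrow> 0) (at_right 0) \<longleftrightarrow>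
      ((\<lambda>r. ennreal (?q r)) \<longlongrightarrow> ennreal 0) (at_right 0)"
    by (simp add: tendsto_cong)
  also have "\<dots> \<longleftrightarrow> (?q \<longlongrightarrow> 0) (at_right 0)"
    by (rule tendsto_ennreal_iff) auto
  also have "\<dots> \<longleftrightarrow> (\<forall>\<epsilon>>0. \<forall>\<^sub>F r in at_right 0. measure \<mu> (A r) \<le> \<epsilon> * measure \<mu> (cball x r))"
  proof (intro iffI allI impI)
    fix \<epsilon> :: real assume "(?q \<longlongrightarrow> 0) (at_right 0)" "\<epsilon> > 0"
    then have "\<forall>\<^sub>F r in at_right 0. ?q r < \<epsilon>" by (rule order_tendstoD)
    with pos show "\<forall>\<^sub>F r in at_right 0. measure \<mu> (A r) \<le> \<epsilon> * measure \<mu> (cball x r)"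
      by eventually_elim (simp add: field_simps)
  next
    assume small: "\<forall>\<epsilon>>0. \<forall>\<^sub>F r in at_right 0. measure \<mu> (A r) \<le> \<epsilon> * measure \<mu> (cball x r)"
    show "(?q \<longlongrightarrow> 0) (at_right 0)"
    proof (rule tendstoI)
      fix e :: real assume "e > 0"
      then have "\<forall>\<^sub>F r in at_right 0. measure \<mu> (A r) \<le> (e / 2) * measure \<mu> (cball x r)"
        using small half_gt_zero by blast
      with pos show "\<forall>\<^sub>F r in at_right 0. dist (?q r) 0 < e"
      proof eventually_elim
        case (elim r)
        then have "?q r \<le> e / 2" by (simp add: field_simps)
        then have "?q r < e" using \<open>e > 0\<close> by linarith
        then show ?case by simp
      qed
    qed
  qed
  finally show ?thesis .
qed

section \<open>Density points\<close>

text \<open>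
Vitali's covering lemma. Only centres have to be covered, so the usual factor \<open>5\<close> can be replaced by
\<open>4\<close>, a power of two and thus convenient for doubling. Take a disjoint family that is maximal among
those with the property that every ball meeting the family meets a member of at least half its
radius. If some ball missed the family altogether, one could add such a ball whose radius is more
than half the supremum of the radii of all balls missing the family, contradicting maximality.
Separability makes disjoint balls countable in number.
\<close>

lemma disjoint_cballs_cover_centres:
  fixes N :: "'a::{metric_space, second_countable_topology} set"
  assumes r: "\<And>x. x \<in> N \<Longrightarrow> 0 < r x \<and> r x \<le> B"
  obtains C where "countable C" "C \<subseteq> N" "disjoint_family_on (\<lambda>x. cball x (r x)) C"
    "N \<subseteq> (\<Union>x\<in>C. cball x (4 * r x))"
proof -
  define meets where "meets x y \<longleftrightarrow> cball x (r x) \<inter> cball y (r y) \<noteq> {}" for x y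
  define \<A> where "\<A> = {C. C \<subseteq> N \<and> disjoint_family_on (\<lambda>x. cball x (r x)) C \<and>
     (\<forall>x\<in>N. (\<exists>y\<in>C. meets x y) \<longrightarrow> (\<exists>y\<in>C. meets x y \<and> r x \<le> 2 * r y))}"
  have "\<exists>C\<in>\<A>. \<forall>X\<in>\<A>. C \<subseteq> X \<longrightarrow> X = C"
  proof (rule subset_Zorn_nonempty)
    have "{} \<in> \<A>" by (auto simp: \<A>_def disjoint_family_on_def)
    then show "\<A> \<noteq> {}" by blast
    fix \<C> assume "\<C> \<noteq> {}" and ch: "subset.chain \<A> \<C>"
    have sub: "\<C> \<subseteq> \<A>" and tot: "\<And>A B. A \<in> \<C> \<Longrightarrow> B \<in> \<C> \<Longrightarrow> A \<subseteq> B \<or> B \<subseteq> A"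
      using ch by (auto simp: subset_chain_def)
    have "disjoint_family_on (\<lambda>x. cball x (r x)) (\<Union>\<C>)"
      unfolding disjoint_family_on_def
    proof (intro ballI impI)
      fix x y assume "x \<in> \<Union>\<C>" "y \<in> \<Union>\<C>" and xy: "x \<noteq> y"
      then obtain A B where AB: "x \<in> A" "A \<in> \<C>" "y \<in> B" "B \<in> \<C>" by blast
      then obtain D where "x \<in> D" "y \<in> D" "D \<in> \<C>" using tot by blast
      then show "cball x (r x) \<inter> cball y (r y) = {}"
        using sub xy unfolding \<A>_def disjoint_family_on_def by blast
    qed
    moreover have "\<exists>y\<in>\<Union>\<C>. meets x y \<and> r x \<le> 2 * r y" if "x \<in> N" "y \<in> \<Union>\<C>" "meets x y" for x y
      using that sub unfolding \<A>_def by blast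
    moreover have "\<Union>\<C> \<subseteq> N" using sub unfolding \<A>_def by blast
    ultimately show "\<Union>\<C> \<in> \<A>" unfolding \<A>_def by blast
  qed
  then obtain C where C: "C \<in> \<A>" and max: "\<And>X. X \<in> \<A> \<Longrightarrow> C \<subseteq> X \<Longrightarrow> X = C" by blast
  have CN: "C \<subseteq> N" and disj: "disjoint_family_on (\<lambda>x. cball x (r x)) C"
    and big: "\<And>x y. x \<in> N \<Longrightarrow> y \<in> C \<Longrightarrow> meets x y \<Longrightarrow> \<exists>y\<in>C. meets x y \<and> r x \<le> 2 * r y"
    using C unfolding \<A>_def by blast+
  have all: "\<exists>y\<in>C. meets x y" if "x \<in> N" for x
  proof (rule ccontr)
    assume no: "\<not> (\<exists>y\<in>C. meets x y)"
    define F where "F = {z\<in>N. \<forall>y\<in>C. \<not> meets z y}"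
    have "x \<in> F" using no that by (simp add: F_def)
    have bdd: "bdd_above (r ` F)" using r by (auto simp: F_def intro!: bdd_aboveI2)
    have "0 < r x" using r that by blast
    have "r x \<le> (SUP z\<in>F. r z)" using \<open>x \<in> F\<close> bdd by (rule cSUP_upper)
    then have "(SUP z\<in>F. r z) / 2 < (SUP z\<in>F. r z)" using \<open>0 < r x\<close> by linarith
    then obtain w where w: "w \<in> F" "(SUP z\<in>F. r z) / 2 < r w"
      using less_cSUP_iff[OF _ bdd] \<open>x \<in> F\<close> by blast
    have le: "r z \<le> 2 * r w" if "z \<in> F" for z
      using cSUP_upper[OF that bdd] w(2) by linarith
    have "w \<in> N" and w': "\<And>y. y \<in> C \<Longrightarrow> \<not> meets w y" using w(1) by (auto simp: F_def)
    have "w \<notin> C" using w'[of w] r[OF \<open>w \<in> N\<close>] by (auto simp: meets_def)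
    have "insert w C \<in> \<A>"
      unfolding \<A>_def mem_Collect_eq
    proof (intro conjI ballI impI)
      show "insert w C \<subseteq> N" using CN \<open>w \<in> N\<close> by blast
      show "disjoint_family_on (\<lambda>x. cball x (r x)) (insert w C)"
        using disj w' unfolding disjoint_family_on_def meets_def by blast
      fix z assume z: "z \<in> N" "\<exists>y\<in>insert w C. meets z y"
      show "\<exists>y\<in>insert w C. meets z y \<and> r z \<le> 2 * r y"
      proof (cases "z \<in> F")
        case True
        then show ?thesis using z le unfolding F_def by blast
      next
        case False
        then show ?thesis using z big unfolding F_def by blast
      qed
    qed
    then show False using max \<open>w \<notin> C\<close> by blast
  qed
  show ?thesis
  proof
    show "countable C"
    proof -
      have dj: "disjnt (ball x (r x)) (ball y (r y))" if "x \<in> C" "y \<in> C" "x \<noteq> y" for x y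
        using disj that ball_subset_cball[of x "r x"] ball_subset_cball[of y "r y"]
        unfolding disjoint_family_on_def disjnt_def by blast
      have inj: "inj_on (\<lambda>x. ball x (r x)) C"
      proof (rule inj_onI, rule ccontr)
        fix x y assume xy: "x \<in> C" "y \<in> C" "ball x (r x) = ball y (r y)" "x \<noteq> y"
        then have "ball x (r x) = {}" using dj[of x y] by (simp add: disjnt_def)
        then show False using r CN xy(1) by (metis ball_eq_empty not_less subsetD)
      qed
      have "countable ((\<lambda>x. ball x (r x)) ` C)"
        by (rule countable_disjoint_open_subsets) (use dj in \<open>auto simp: pairwise_def\<close>)
      then show ?thesis using inj countable_image_inj_on by blast
    qed
    show "N \<subseteq> (\<Union>x\<in>C. cball x (4 * r x))"
    proof
      fix x assume x: "x \<in> N"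
      then obtain y where y: "y \<in> C" "meets x y" "r x \<le> 2 * r y" using all big by blast
      then obtain z where "dist x z \<le> r x" "dist y z \<le> r y" unfolding meets_def by auto
      then have "dist y x \<le> 3 * r y" using y(3) dist_triangle[of y x z] by (simp add: dist_commute)
      moreover have "0 < r y" using y(1) CN r by blast
      ultimately show "x \<in> (\<Union>x\<in>C. cball x (4 * r x))" using y(1) by (intro UN_I[of y]) auto
    qed
  qed (use CN disj in auto)
qed

lemma emeasure_UN_le_disjoint:
  assumes C: "countable C" and A: "\<And>x. x \<in> C \<Longrightarrow> A x \<in> sets M" and B: "\<And>x. x \<in> C \<Longrightarrow> B x \<in> sets M"
    and disj: "disjoint_family_on B C"
    and le: "\<And>x. x \<in> C \<Longrightarrow> emeasure M (A x) \<le> c * emeasure M (B x)"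
    and G: "G \<in> sets M" "\<And>x. x \<in> C \<Longrightarrow> B x \<subseteq> G"
  shows "emeasure M (\<Union>x\<in>C. A x) \<le> c * emeasure M G"
proof -
  let ?I = "to_nat_on C ` C" and ?x = "from_nat_into C"
  define A' where "A' n = (if n \<in> ?I then A (?x n) else {})" for n
  define B' where "B' n = (if n \<in> ?I then B (?x n) else {})" for n
  have xC: "?x n \<in> C" if "n \<in> ?I" for n using that by (auto intro: from_nat_into)
  have sets': "A' n \<in> sets M" "B' n \<in> sets M" for n using A B xC by (auto simp: A'_def B'_def)
  have "disjoint_family B'"
    unfolding disjoint_family_on_def
  proof (intro ballI impI)
    fix k n :: nat assume "k \<noteq> n"
    have "?x k \<noteq> ?x n" if "k \<in> ?I" "n \<in> ?I"
      using to_nat_on_from_nat_into[of k C] to_nat_on_from_nat_into[of n C] that \<open>k \<noteq> n\<close> by metis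
    then show "B' k \<inter> B' n = {}"
      using disj xC by (auto simp: B'_def disjoint_family_on_def)
  qed
  have "(\<Union>x\<in>C. A x) = (\<Union>n. A' n)"
  proof (intro set_eqI iffI)
    fix z assume "z \<in> (\<Union>x\<in>C. A x)"
    then obtain x where x: "x \<in> C" "z \<in> A x" by blast
    then have "z \<in> A' (to_nat_on C x)" using C by (simp add: A'_def)
    then show "z \<in> (\<Union>n. A' n)" by blast
  next
    fix z assume "z \<in> (\<Union>n. A' n)"
    then show "z \<in> (\<Union>x\<in>C. A x)" using xC by (auto simp: A'_def split: if_splits)
  qed
  then have "emeasure M (\<Union>x\<in>C. A x) \<le> (\<Sum>n. emeasure M (A' n))"
    using sets' by (simp add: emeasure_subadditive_countably image_subset_iff)
  also have "\<dots> \<le> (\<Sum>n. c * emeasure M (B' n))"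
    using le xC by (intro suminf_le) (auto simp: A'_def B'_def)
  also have "\<dots> = c * emeasure M (\<Union>n. B' n)"
    using \<open>disjoint_family B'\<close> sets' by (simp add: suminf_emeasure image_subset_iff)
  also have "\<dots> \<le> c * emeasure M G"
    using G xC sets' by (intro mult_left_mono emeasure_mono) (auto simp: B'_def split: if_splits)
  finally show ?thesis .
qed

text \<open>
The measure \<open>\<nu>\<close> that \<open>\<mu>\<close> induces on \<open>ball 0 R - E\<close> is finite and vanishes on \<open>E\<close>, so by outer
regularity \<open>E\<close> has an open neighbourhood of small \<open>\<nu>\<close>-measure. Each point of \<open>N\<close> is the centre of
a ball inside that neighbourhood in which \<open>\<nu>\<close> is at least the fraction \<open>\<epsilon>\<close> of \<open>\<mu>\<close>. Choose disjoint
ones whose fourfold enlargements cover \<open>N\<close>; by doubling, the enlargements have \<open>\<mu>\<close>-measure at most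
\<open>K\<^sup>2 / \<epsilon>\<close> times the \<open>\<nu>\<close>-measure of the disjoint balls.
\<close>

lemma low_density_points_small:
  assumes \<mu>: "pointwise_doubling \<mu>" and E: "E \<in> sets borel" and "\<epsilon> > 0" "\<delta> > 0"
    and NE: "N \<subseteq> E \<inter> ball 0 R" and dbl: "\<And>x. x \<in> N \<Longrightarrow> doubling_at \<mu> K \<delta> x"
    and low: "\<And>x \<rho>. x \<in> N \<Longrightarrow> \<rho> > 0 \<Longrightarrow> \<exists>r>0. r \<le> \<rho> \<and> \<epsilon> * measure \<mu> (cball x r) < measure \<mu> (cball x r - E)"
    and "e > 0"
  shows "\<exists>Z\<in>sets \<mu>. N \<subseteq> Z \<and> emeasure \<mu> Z \<le> ennreal e"
proof -
  note sets_\<mu> = pointwise_doubling_sets[OF \<mu>]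
  \<comment> \<open>The summand \<open>1\<close> only keeps \<open>c\<close> positive when \<open>K = 0\<close>.\<close>
  define c where "c = real K ^ 2 / \<epsilon> + 1"
  have "c > 0" using \<open>\<epsilon> > 0\<close> by (simp add: c_def add_nonneg_pos)
  let ?M = "density \<mu> (indicator (ball 0 R - E))"
  have B_sets: "ball 0 R - E \<in> sets \<mu>" using E sets_\<mu> by auto
  have M: "emeasure ?M A = emeasure \<mu> ((ball 0 R - E) \<inter> A)" if "A \<in> sets borel" for A
    using that B_sets sets_\<mu> by (intro emeasure_restricted) auto
  have space_\<mu>: "space \<mu> = UNIV" using sets_eq_imp_space_eq[OF sets_\<mu>] by simp
  have "ball 0 R - E \<in> fmeasurable \<mu>"
    using E by (intro pointwise_doubling_fmeasurable[OF \<mu>]) (auto intro: bounded_subset[OF bounded_ball])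
  then have "emeasure ?M (space ?M) \<noteq> \<infinity>"
    by (simp add: M space_\<mu> fmeasurableD2)
  then have "(INF U\<in>{U. E \<subseteq> U \<and> open U}. emeasure ?M U) = emeasure ?M E"
    using outer_regular[of ?M E] E sets_\<mu> by simp
  also have "\<dots> = 0"
  proof -
    have "(ball 0 R - E) \<inter> E = {}" by blast
    then show ?thesis using E by (simp add: M)
  qed
  also have "0 < ennreal (e / c)" using \<open>e > 0\<close> \<open>c > 0\<close> by simp
  finally obtain U where U: "E \<subseteq> U" "open U" "emeasure ?M U < ennreal (e / c)"
    by (auto simp: INF_less_iff)
  define W where "W = U \<inter> ball 0 R"
  have W: "open W" "N \<subseteq> W" using U NE by (auto simp: W_def)
  have "emeasure \<mu> (W - E) = emeasure ?M U"
    using U(2) by (subst M) (auto simp: W_def intro!: arg_cong[where f = "emeasure \<mu>"])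
  then have small: "emeasure \<mu> (W - E) \<le> ennreal (e / c)" using U(3) by simp
  have "\<exists>r. 0 < r \<and> r \<le> \<delta> / 2 \<and> cball x r \<subseteq> W \<and>
      \<epsilon> * measure \<mu> (cball x r) < measure \<mu> (cball x r - E)" if x: "x \<in> N" for x
  proof -
    obtain s where s: "s > 0" "cball x s \<subseteq> W"
      using open_contains_cball_eq[OF W(1)] W(2) x by blast
    obtain r where r: "r > 0" "r \<le> min s (\<delta> / 2)"
        "\<epsilon> * measure \<mu> (cball x r) < measure \<mu> (cball x r - E)"
      using low[OF x, of "min s (\<delta> / 2)"] s(1) \<open>\<delta> > 0\<close> by auto
    have "cball x r \<subseteq> cball x s" using r(2) by (intro subset_cball) simp
    then show ?thesis using r s by auto
  qed
  then obtain r where r: "\<And>x. x \<in> N \<Longrightarrow> 0 < r x \<and> r x \<le> \<delta> / 2"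
      and rW: "\<And>x. x \<in> N \<Longrightarrow> cball x (r x) \<subseteq> W"
      and rE: "\<And>x. x \<in> N \<Longrightarrow> \<epsilon> * measure \<mu> (cball x (r x)) < measure \<mu> (cball x (r x) - E)"
    by metis
  obtain C where C: "countable C" "C \<subseteq> N" "disjoint_family_on (\<lambda>x. cball x (r x)) C"
      "N \<subseteq> (\<Union>x\<in>C. cball x (4 * r x))"
    using disjoint_cballs_cover_centres[of N r "\<delta> / 2", OF r] .
  have "emeasure \<mu> (\<Union>x\<in>C. cball x (4 * r x)) \<le> ennreal c * emeasure \<mu> (W - E)"
  proof (rule emeasure_UN_le_disjoint[where B = "\<lambda>x. cball x (r x) - E"])
    show "disjoint_family_on (\<lambda>x. cball x (r x) - E) C"
      using C(3) by (auto simp: disjoint_family_on_def)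
    fix x assume "x \<in> C"
    then have x: "x \<in> N" using C(2) by blast
    have "measure \<mu> (cball x (4 * r x)) \<le> real K ^ 2 * measure \<mu> (cball x (r x))"
      using doubling_at_iterate[OF dbl[OF x], of "4 * r x" 2] r[OF x] by simp
    also have "\<dots> = real K ^ 2 / \<epsilon> * (\<epsilon> * measure \<mu> (cball x (r x)))"
      using \<open>\<epsilon> > 0\<close> by simp
    also have "\<dots> \<le> c * measure \<mu> (cball x (r x) - E)"
      using rE[OF x] \<open>\<epsilon> > 0\<close> by (intro mult_mono) (auto simp: c_def add_nonneg_pos)
    finally have "ennreal (measure \<mu> (cball x (4 * r x))) \<le> ennreal (c * measure \<mu> (cball x (r x) - E))"
      by (rule ennreal_leI)
    moreover have "emeasure \<mu> (cball x (4 * r x)) = ennreal (measure \<mu> (cball x (4 * r x)))"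
      by (intro emeasure_eq_measure2 cball_fmeasurable[OF \<mu>])
    moreover have "emeasure \<mu> (cball x (r x) - E) = ennreal (measure \<mu> (cball x (r x) - E))"
      using E by (intro emeasure_eq_measure2 subset_cball_fmeasurable[OF \<mu>]) auto
    ultimately show "emeasure \<mu> (cball x (4 * r x)) \<le> ennreal c * emeasure \<mu> (cball x (r x) - E)"
      using \<open>c > 0\<close> by (simp add: ennreal_mult)
    show "cball x (r x) - E \<subseteq> W - E" using rW[OF x] by blast
  qed (use C(1) E W(1) sets_\<mu> in auto)
  also have "\<dots> \<le> ennreal c * ennreal (e / c)" using small by (rule mult_left_mono) simp
  also have "\<dots> = ennreal e" using \<open>c > 0\<close> \<open>e > 0\<close> by (simp add: ennreal_mult[symmetric])
  finally have "emeasure \<mu> (\<Union>x\<in>C. cball x (4 * r x)) \<le> ennreal e" .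
  moreover have "(\<Union>x\<in>C. cball x (4 * r x)) \<in> sets \<mu>"
    unfolding sets_\<mu> using C(1) by (intro sets.countable_UN'') auto
  ultimately show ?thesis using C(4) by blast
qed

lemma subset_null_set_if_small_covers:
  assumes "\<And>e::real. e > 0 \<Longrightarrow> \<exists>Z\<in>sets M. N \<subseteq> Z \<and> emeasure M Z \<le> ennreal e"
  obtains Z where "Z \<in> null_sets M" "N \<subseteq> Z"
proof -
  have "\<exists>Z\<in>sets M. N \<subseteq> Z \<and> emeasure M Z \<le> ennreal (1 / real (Suc n))" for n
    by (rule assms) simp
  then obtain Z where Z: "\<And>n. Z n \<in> sets M" "\<And>n. N \<subseteq> Z n"
      "\<And>n. emeasure M (Z n) \<le> ennreal (1 / real (Suc n))"
    by metis
  have "emeasure M (\<Inter>n. Z n) \<le> 0"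
  proof (rule ennreal_le_epsilon)
    fix e :: real assume "e > 0"
    then obtain n where n: "1 / real (Suc n) < e" using nat_approx_posE by blast
    have "emeasure M (\<Inter>n. Z n) \<le> emeasure M (Z n)" using Z(1) by (intro emeasure_mono) auto
    also have "\<dots> \<le> ennreal (1 / real (Suc n))" by (rule Z)
    also have "\<dots> \<le> ennreal e" using n by (intro ennreal_leI) simp
    finally show "emeasure M (\<Inter>n. Z n) \<le> 0 + ennreal e" by simp
  qed
  then have "(\<Inter>n. Z n) \<in> null_sets M" using Z(1) by (auto simp: null_sets_def)
  then show ?thesis using that Z(2) by blast
qed

text \<open>
Lebesgue's density theorem. In an infinite-dimensional space it fails for general measures; here
doubling stands in for the Besicovitch covering theorem. The exceptional points are sorted into
countably many sets with uniform constants, so that the preceding estimate applies to each.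
\<close>

theorem pointwise_doubling_density:
  assumes \<mu>: "pointwise_doubling \<mu>" and E: "E \<in> sets borel"
  shows "AE x in \<mu>. x \<in> E \<longrightarrow>
    ((\<lambda>r. emeasure \<mu> (cball x r - E) / emeasure \<mu> (cball x r)) \<longlongrightarrow> 0) (at_right 0)"
proof -
  define N where "N K j i n = {x \<in> E \<inter> ball 0 (real n). doubling_at \<mu> K (1 / real (Suc j)) x \<and>
     (\<forall>\<rho>>0. \<exists>r>0. r \<le> \<rho> \<and> 1 / real (Suc i) * measure \<mu> (cball x r) < measure \<mu> (cball x r - E))}"
    for K j i n
  have "AE x in \<mu>. x \<notin> N K j i n" for K j i n
  proof -
    obtain Z where "Z \<in> null_sets \<mu>" "N K j i n \<subseteq> Z"
    proof (rule subset_null_set_if_small_covers)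
      fix e :: real assume "e > 0"
      then show "\<exists>Z\<in>sets \<mu>. N K j i n \<subseteq> Z \<and> emeasure \<mu> Z \<le> ennreal e"
        by (intro low_density_points_small[OF \<mu> E, where \<epsilon> = "1 / real (Suc i)"
              and \<delta> = "1 / real (Suc j)" and K = K and R = "real n"]) (auto simp: N_def)
    qed
    then show ?thesis by (intro AE_I'[of Z]) auto
  qed
  then have "AE x in \<mu>. \<forall>K j i n. x \<notin> N K j i n" by (simp add: AE_all_countable)
  then show ?thesis using AE_doubling_at[OF \<mu>]
  proof eventually_elim
    case (elim x)
    then obtain K j where x: "doubling_at \<mu> K (1 / real (Suc j)) x" by blast
    show ?case
    proof
      assume "x \<in> E"
      obtain n where n: "norm x < real n" using reals_Archimedean2 by blast
      have "\<forall>\<^sub>F r in at_right 0. measure \<mu> (cball x r - E) \<le> \<epsilon> * measure \<mu> (cball x r)" if "\<epsilon> > 0" for \<epsilon>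
      proof -
        obtain i where i: "1 / real (Suc i) < \<epsilon>" using \<open>\<epsilon> > 0\<close> nat_approx_posE by blast
        have "x \<notin> N K j i n" using elim by blast
        then obtain \<rho> where \<rho>: "\<rho> > 0" and le: "\<And>r. r > 0 \<Longrightarrow> r \<le> \<rho> \<Longrightarrow>
            measure \<mu> (cball x r - E) \<le> 1 / real (Suc i) * measure \<mu> (cball x r)"
          using x \<open>x \<in> E\<close> n unfolding N_def by (force simp: not_less)
        have "measure \<mu> (cball x r - E) \<le> \<epsilon> * measure \<mu> (cball x r)" if "0 < r" "r < \<rho>" for r
        proof -
          have "1 / real (Suc i) * measure \<mu> (cball x r) \<le> \<epsilon> * measure \<mu> (cball x r)"
            using i by (intro mult_right_mono) auto
          then show ?thesis using le[of r] that by linarith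
        qed
        then show ?thesis using \<rho> unfolding eventually_at_right_field by blast
      qed
      then show "((\<lambda>r. emeasure \<mu> (cball x r - E) / emeasure \<mu> (cball x r)) \<longlongrightarrow> 0) (at_right 0)"
        by (subst cball_ratio_tendsto_0_iff[OF \<mu> x]) (use E in auto)
    qed
  qed
qed

section \<open>Cone decay forces Lipschitz graphs\<close>

lemma good_cone_mono: "\<alpha> \<le> \<beta> \<Longrightarrow> good_cone x V \<alpha> \<subseteq> good_cone x V \<beta>"
  unfolding good_cone_def by (auto intro: order_trans[OF _ mult_right_mono])

text \<open>
The points at which doubling and cone decay hold with the same constants. Two points in the ball
of radius \<open>\<delta> / 4\<close> have distance \<open>d \<le> \<delta> / 2\<close>, so that both properties are at hand at radius \<open>2 d\<close>.
\<close>

definition cone_piece :: "'a::{real_inner, polish_space} measure \<Rightarrow> 'a set \<Rightarrow> real \<Rightarrow> nat \<Rightarrow> real \<Rightarrow> real \<Rightarrow> 'a \<Rightarrow> 'a set" where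
  "cone_piece \<mu> V \<alpha> K \<epsilon> \<delta> z = {x \<in> ball z (\<delta> / 4). doubling_at \<mu> K \<delta> x \<and>
     (\<forall>r. 0 < r \<and> r \<le> \<delta> \<longrightarrow> measure \<mu> (bad_cone_ball x r V \<alpha>) \<le> \<epsilon> * measure \<mu> (cball x r))}"

text \<open>
Suppose that \<open>y\<close> lies outside the good cone at \<open>x\<close> of the larger aperture \<open>\<beta> = (1 + \<alpha>) / 2\<close>, at distance
\<open>d\<close> from \<open>x\<close>. Then a ball around \<open>y\<close> of radius comparable to \<open>d\<close> is contained in the bad cone of
aperture \<open>\<alpha>\<close>, inside \<open>cball x (2 * d)\<close>. Decay at \<open>x\<close> says that it carries at most the fraction
\<open>\<epsilon>\<close> of the mass of \<open>cball x (2 * d) \<subseteq> cball y (4 * d)\<close>, while doubling at \<open>y\<close> says that it carries at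
least the fraction \<open>1 / K ^ p\<close> of the mass of \<open>cball y (4 * d)\<close>. This is impossible as soon as
\<open>\<epsilon> K ^ p < 1\<close>, and \<open>p\<close> depends on \<open>\<alpha>\<close> alone.
\<close>

lemma cone_piece_imp_good_cone:
  fixes \<mu> :: "'a::{real_inner, polish_space} measure"
  assumes \<mu>: "pointwise_doubling \<mu>" and \<alpha>: "0 < \<alpha>" "\<alpha> < 1"
  shows "\<exists>\<epsilon>>0. \<forall>V \<delta> z. 0 \<in> V \<longrightarrow> (\<forall>x \<in> cone_piece \<mu> V \<alpha> K \<epsilon> \<delta> z.
    \<forall>y \<in> cone_piece \<mu> V \<alpha> K \<epsilon> \<delta> z. y \<in> good_cone x V ((1 + \<alpha>) / 2))"
proof -
  define \<beta> where "\<beta> = (1 + \<alpha>) / 2"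
  \<comment> \<open>The largest \<open>c\<close> for which \<open>cball y (c * d)\<close> stays in the bad cone of aperture \<open>\<alpha>\<close>.\<close>
  define c where "c = (\<beta> - \<alpha>) / (1 + \<alpha>)"
  have c: "0 < c" "c \<le> 1" "\<alpha> * (1 + c) = \<beta> - c"
    using \<alpha> by (auto simp: c_def \<beta>_def field_simps)
  obtain p where p: "4 / 2 ^ p \<le> c"
  proof -
    obtain p where "4 / c < 2 ^ p" using real_arch_pow[of 2 "4 / c"] by auto
    then show ?thesis using that[of p] c(1) by (simp add: field_simps)
  qed
  define \<epsilon> where "\<epsilon> = 1 / (real K ^ p + 1)"
  have Kp: "real K ^ p + 1 > 0" by (simp add: add_nonneg_pos)
  have "\<epsilon> > 0" using Kp by (simp add: \<epsilon>_def)
  moreover have "y \<in> good_cone x V \<beta>"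
    if V: "0 \<in> V" and x: "x \<in> cone_piece \<mu> V \<alpha> K \<epsilon> \<delta> z" and y': "y \<in> cone_piece \<mu> V \<alpha> K \<epsilon> \<delta> z" for V \<delta> z x y
  proof (rule ccontr)
    assume "y \<notin> good_cone x V \<beta>"
    have y: "doubling_at \<mu> K \<delta> y" using y' by (simp add: cone_piece_def)
    have decay: "measure \<mu> (bad_cone_ball x r V \<alpha>) \<le> \<epsilon> * measure \<mu> (cball x r)" if "0 < r" "r \<le> \<delta>" for r
      using x that by (simp add: cone_piece_def)
    have close: "dist x y \<le> \<delta> / 2"
      using x y' dist_triangle2[of x y z] by (simp add: cone_piece_def dist_commute)
    from \<open>y \<notin> good_cone x V \<beta>\<close> have far: "\<beta> * norm (x - y) < infdist (y - x) V" by (simp add: good_cone_def)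
    define d where "d = dist x y"
    have "x \<noteq> y" using far V by auto
    then have "d > 0" by (simp add: d_def)
    define s where "s = 4 * d / 2 ^ p"
    have s: "0 < s" "s \<le> c * d"
      using p \<open>d > 0\<close> mult_right_mono[OF p, of d] by (auto simp: s_def)
    have "cball y s \<subseteq> bad_cone_ball x (2 * d) V \<alpha>"
    proof
      fix z assume "z \<in> cball y s"
      then have z: "dist y z \<le> c * d" using s by simp
      have "infdist (y - x) V \<le> infdist (z - x) V + dist (y - x) (z - x)"
        by (rule infdist_triangle)
      moreover have "dist (y - x) (z - x) = dist y z" by (simp add: dist_norm)
      ultimately have "\<beta> * d - c * d < infdist (z - x) V"
        using far z by (simp add: d_def dist_norm)
      moreover have xz: "dist x z \<le> d + c * d"
        using dist_triangle[of x z y] z by (simp add: d_def)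
      then have "\<alpha> * dist x z \<le> \<alpha> * ((1 + c) * d)"
        using \<alpha> by (intro mult_left_mono) (auto simp: algebra_simps)
      moreover have "\<alpha> * ((1 + c) * d) = \<beta> * d - c * d"
        using c(3) by (metis left_diff_distrib mult.assoc)
      ultimately have "z \<notin> good_cone x V \<alpha>" by (simp add: good_cone_def dist_norm)
      moreover have "c * d \<le> 1 * d" using c \<open>d > 0\<close> by (intro mult_right_mono) auto
      ultimately show "z \<in> bad_cone_ball x (2 * d) V \<alpha>"
        using xz by (simp add: bad_cone_ball_def bad_cone_def)
    qed
    then have "measure \<mu> (cball y s) \<le> measure \<mu> (bad_cone_ball x (2 * d) V \<alpha>)"
      by (intro measure_mono_cball[OF \<mu>, where x = x and r = "2 * d"])
        (auto simp: bad_cone_ball_borel, auto simp: bad_cone_ball_def)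
    also have "\<dots> \<le> \<epsilon> * measure \<mu> (cball x (2 * d))"
      using \<open>d > 0\<close> close by (intro decay) (auto simp: d_def)
    also have "\<dots> \<le> \<epsilon> * measure \<mu> (cball y (4 * d))"
    proof (intro mult_left_mono measure_mono_cball[OF \<mu>])
      show "cball x (2 * d) \<subseteq> cball y (4 * d)"
      proof
        fix z assume "z \<in> cball x (2 * d)"
        then have "dist x z \<le> 2 * d" by simp
        moreover have "dist y z \<le> d + dist x z" using dist_triangle[of y z x] by (simp add: d_def dist_commute)
        ultimately have "dist y z \<le> 4 * d" using \<open>d > 0\<close> by linarith
        then show "z \<in> cball y (4 * d)" by simp
      qed
    qed (use \<open>\<epsilon> > 0\<close> in auto)
    also have "\<dots> \<le> \<epsilon> * (real K ^ p * measure \<mu> (cball y s))"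
      unfolding s_def using \<open>d > 0\<close> \<open>\<epsilon> > 0\<close> close
      by (intro mult_left_mono doubling_at_iterate[OF y]) (auto simp: d_def)
    finally have "1 * measure \<mu> (cball y s) \<le> real K ^ p / (real K ^ p + 1) * measure \<mu> (cball y s)"
      by (simp add: \<epsilon>_def)
    moreover have "0 < measure \<mu> (cball y s)"
    proof (rule doubling_atD(1)[OF y s(1)])
      have "c * d \<le> 1 * d" using c \<open>d > 0\<close> by (intro mult_right_mono) auto
      moreover have "2 * d \<le> \<delta>" using close by (simp add: d_def)
      ultimately show "s \<le> \<delta>" using s \<open>d > 0\<close> by linarith
    qed
    ultimately have "1 \<le> real K ^ p / (real K ^ p + 1)" by (rule mult_right_le_imp_le)
    then show False using Kp by (simp add: field_simps)
  qed
  ultimately show ?thesis unfolding \<beta>_def by blast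
qed

text \<open>
Frames, apertures, doubling constants, radii and centres are each restricted to a countable set.
The resulting pieces cover almost every point because cones may be widened slightly, which leaves
room to replace \<open>V\<close> by a plane of the countable family and \<open>\<alpha>\<close> by some \<open>a n\<close>. The decay required
in a piece depends on \<open>a n\<close> and \<open>K\<close> only and is available on small balls since the limit is zero.
\<close>

lemma cone_decay_imp_carried:
  fixes \<mu> :: "'a::{real_inner, polish_space} measure"
  assumes \<mu>: "pointwise_doubling \<mu>"
    and cone: "AE x in \<mu>. \<exists>V \<alpha>. m_plane m V \<and> 0 < \<alpha> \<and> \<alpha> < 1 \<and>
      ((\<lambda>r. emeasure \<mu> (bad_cone_ball x r V \<alpha>) / emeasure \<mu> (cball x r)) \<longlongrightarrow> 0) (at_right 0)"
  shows "carried_by_lipschitz_graphs m \<mu>"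
proof -
  define a where "a n = 1 - 1 / real (n + 2)" for n :: nat
  have a: "0 < a n" "a n < 1" for n by (auto simp: a_def)
  have "\<forall>n K. \<exists>\<epsilon>>0. \<forall>V \<delta> z. 0 \<in> V \<longrightarrow> (\<forall>x \<in> cone_piece \<mu> V (a n) K \<epsilon> \<delta> z.
      \<forall>y \<in> cone_piece \<mu> V (a n) K \<epsilon> \<delta> z. y \<in> good_cone x V ((1 + a n) / 2))"
    using cone_piece_imp_good_cone[OF \<mu> a] by blast
  then obtain \<epsilon> where \<epsilon>_pos: "\<And>n K. \<epsilon> n K > 0" and
    \<epsilon>: "\<And>n K V \<delta> z x y. 0 \<in> V \<Longrightarrow> x \<in> cone_piece \<mu> V (a n) K (\<epsilon> n K) \<delta> z \<Longrightarrow>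
      y \<in> cone_piece \<mu> V (a n) K (\<epsilon> n K) \<delta> z \<Longrightarrow> y \<in> good_cone x V ((1 + a n) / 2)"
    by metis
  obtain T :: "(nat \<Rightarrow> 'a) set" where T: "countable T" "\<And>b. b \<in> T \<Longrightarrow> orthonormal_frame m b"
    "\<And>b \<eta>. orthonormal_frame m b \<Longrightarrow> \<eta> > 0 \<Longrightarrow> \<exists>c\<in>T. \<forall>i<m. norm (b i - c i) < \<eta>"
    using countable_dense_frames by metis
  obtain D :: "'a set" where D: "countable D" "UNIV \<subseteq> closure D"
    using separable[of "UNIV :: 'a set"] by auto
  define piece where "piece = (\<lambda>(b, n, K, j, z). cone_piece \<mu> (frame_span m b) (a n) K (\<epsilon> n K) (1 / real (Suc j)) z)"
  define I where "I = T \<times> (UNIV :: nat set) \<times> (UNIV :: nat set) \<times> (UNIV :: nat set) \<times> D"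
  have "\<exists>\<Gamma>. (\<exists>L. lipschitz_graph m L \<Gamma>) \<and> piece i \<subseteq> \<Gamma>" if "i \<in> I" for i
  proof -
    obtain b n K j z where i: "i = (b, n, K, j, z)" by (cases i) auto
    then have b: "orthonormal_frame m b" using that T(2) by (simp add: I_def)
    have "\<exists>L \<Gamma>. lipschitz_graph m L \<Gamma> \<and> piece i \<subseteq> \<Gamma>"
    proof (rule good_cone_condition_imp_graph[OF b])
      show "0 \<le> (1 + a n) / 2" "(1 + a n) / 2 < 1" using a[of n] by auto
    qed (auto simp: piece_def i intro: \<epsilon> span_zero)
    then show ?thesis by blast
  qed
  then obtain \<Gamma> where \<Gamma>: "\<And>i. i \<in> I \<Longrightarrow> \<exists>L. lipschitz_graph m L (\<Gamma> i)" "\<And>i. i \<in> I \<Longrightarrow> piece i \<subseteq> \<Gamma> i"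
    by metis
  have cG: "countable (\<Gamma> ` I)" unfolding I_def using T(1) D(1) by (intro countable_image countable_SIGMA) auto
  have "AE x in \<mu>. x \<in> \<Union>(\<Gamma> ` I)"
    using cone AE_doubling_at[OF \<mu>]
  proof eventually_elim
    case (elim x)
    then obtain V \<alpha> K j\<^sub>0 where V: "m_plane m V" and \<alpha>: "0 < \<alpha>" "\<alpha> < 1"
      and lim: "((\<lambda>r. emeasure \<mu> (bad_cone_ball x r V \<alpha>) / emeasure \<mu> (cball x r)) \<longlongrightarrow> 0) (at_right 0)"
      and dbl: "doubling_at \<mu> K (1 / real (Suc j\<^sub>0)) x"
      by blast
    obtain b where b: "orthonormal_frame m b" "V = frame_span m b"
      using m_plane_obtain_frame[OF V] .
    \<comment> \<open>Half of the room between \<open>\<alpha>\<close> and \<open>1\<close> goes into moving the plane, half of it into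
        rounding the aperture.\<close>
    define \<eta> where "\<eta> = (1 - \<alpha>) / 2 / real (Suc m)"
    have "\<eta> > 0" using \<alpha> by (simp add: \<eta>_def del: of_nat_Suc)
    have "real m * \<eta> \<le> real (Suc m) * \<eta>" using \<open>\<eta> > 0\<close> by (intro mult_right_mono) auto
    then have m\<eta>: "real m * \<eta> \<le> (1 - \<alpha>) / 2" by (simp add: \<eta>_def del: of_nat_Suc)
    obtain c where c: "c \<in> T" "\<And>i. i < m \<Longrightarrow> norm (b i - c i) < \<eta>"
      using T(3)[OF b(1) \<open>\<eta> > 0\<close>] by blast
    obtain n where "1 / real (Suc n) < (1 - \<alpha>) / 2" using \<alpha> nat_approx_posE[of "(1 - \<alpha>) / 2"] by auto
    moreover have "1 / real (n + 2) \<le> 1 / real (Suc n)" by (intro divide_left_mono) auto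
    ultimately have "1 / real (n + 2) \<le> (1 - \<alpha>) / 2" by (rule order_trans[OF _ less_imp_le, rotated])
    moreover have "1 / real (n + 2) = 1 - a n" by (simp only: a_def diff_diff_eq2 add_diff_cancel_left')
    ultimately have n: "\<alpha> + real m * \<eta> \<le> a n" using m\<eta> by argo
    have "good_cone x V \<alpha> \<subseteq> good_cone x (frame_span m c) (\<alpha> + real m * \<eta>)"
      unfolding b(2) by (rule good_cone_perturb[OF b(1)]) (use c(2) less_imp_le in blast)
    also have "\<dots> \<subseteq> good_cone x (frame_span m c) (a n)" by (rule good_cone_mono[OF n])
    finally have sub: "bad_cone_ball x r (frame_span m c) (a n) \<subseteq> bad_cone_ball x r V \<alpha>" for r
      by (auto simp: bad_cone_ball_def bad_cone_def)
    have "\<forall>\<^sub>F r in at_right 0. measure \<mu> (bad_cone_ball x r V \<alpha>) \<le> \<epsilon> n K * measure \<mu> (cball x r)"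
      using lim \<epsilon>_pos cball_ratio_tendsto_0_iff[OF \<mu> dbl, of "\<lambda>r. bad_cone_ball x r V \<alpha>"]
      by (auto simp: bad_cone_ball_borel) (auto simp: bad_cone_ball_def)
    then obtain j\<^sub>1 where j\<^sub>1: "\<And>r. 0 < r \<Longrightarrow> r \<le> 1 / real (Suc j\<^sub>1) \<Longrightarrow>
        measure \<mu> (bad_cone_ball x r V \<alpha>) \<le> \<epsilon> n K * measure \<mu> (cball x r)"
      using eventually_at_right_0_Suc by blast
    define j where "j = max j\<^sub>0 j\<^sub>1"
    have j: "1 / real (Suc j) \<le> 1 / real (Suc j\<^sub>0)" "1 / real (Suc j) \<le> 1 / real (Suc j\<^sub>1)"
      by (auto simp: j_def intro!: divide_left_mono)
    have "x \<in> closure D" using D(2) by blast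
    then obtain z where z: "z \<in> D" "dist z x < 1 / real (Suc j) / 4"
      unfolding closure_approachable by (metis divide_pos_pos of_nat_0_less_iff zero_less_Suc zero_less_numeral zero_less_one)
    have "x \<in> piece (c, n, K, j, z)"
      unfolding piece_def cone_piece_def prod.case mem_Collect_eq
    proof (intro conjI allI impI)
      show "x \<in> ball z (1 / real (Suc j) / 4)" using z(2) by simp
      show "doubling_at \<mu> K (1 / real (Suc j)) x" using dbl j(1) by (rule doubling_at_mono)
      fix r assume r: "0 < r \<and> r \<le> 1 / real (Suc j)"
      have "measure \<mu> (bad_cone_ball x r (frame_span m c) (a n)) \<le> measure \<mu> (bad_cone_ball x r V \<alpha>)"
        using sub by (intro measure_mono_cball[OF \<mu>, where x = x and r = r] bad_cone_ball_borel)
          (auto simp: bad_cone_ball_def)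
      also have "\<dots> \<le> \<epsilon> n K * measure \<mu> (cball x r)" using r j(2) by (intro j\<^sub>1) auto
      finally show "measure \<mu> (bad_cone_ball x r (frame_span m c) (a n)) \<le> \<epsilon> n K * measure \<mu> (cball x r)" .
    qed
    moreover have "(c, n, K, j, z) \<in> I" using c(1) z(1) by (simp add: I_def)
    ultimately show ?case using \<Gamma>(2) by blast
  qed
  moreover have "\<Union>(\<Gamma> ` I) \<in> sets borel"
    using cG \<Gamma>(1) by (intro sets.countable_Union) (blast intro: borel_closed lipschitz_graph_closed)+
  then have "UNIV - \<Union>(\<Gamma> ` I) \<in> sets \<mu>" using pointwise_doubling_sets[OF \<mu>] by auto
  moreover have "space \<mu> = UNIV" using sets_eq_imp_space_eq[OF pointwise_doubling_sets[OF \<mu>]] by simp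
  ultimately have "emeasure \<mu> (UNIV - \<Union>(\<Gamma> ` I)) = 0"
    by (subst (asm) AE_iff_measurable[where N = "UNIV - \<Union>(\<Gamma> ` I)"]) auto
  then show ?thesis
    unfolding carried_by_lipschitz_graphs_def using cG \<Gamma>(1) by blast
qed

section \<open>The equivalence\<close>

text \<open>
At a point of a graph the bad cone of suitable aperture misses the graph, so its mass in
\<open>cball x r\<close> is negligible at every density point of the graph.
\<close>

lemma carried_imp_cone_decay:
  fixes \<mu> :: "'a::{real_inner, polish_space} measure"
  assumes \<mu>: "pointwise_doubling \<mu>" and carried: "carried_by_lipschitz_graphs m \<mu>"
  shows "AE x in \<mu>. \<exists>V \<alpha>. m_plane m V \<and> 0 < \<alpha> \<and> \<alpha> < 1 \<and>
    ((\<lambda>r. emeasure \<mu> (bad_cone_ball x r V \<alpha>) / emeasure \<mu> (cball x r)) \<longlongrightarrow> 0) (at_right 0)"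
proof -
  obtain G where G: "countable G" "\<And>\<Gamma>. \<Gamma> \<in> G \<Longrightarrow> \<exists>L. lipschitz_graph m L \<Gamma>"
    and null: "emeasure \<mu> (UNIV - \<Union>G) = 0"
    using carried by (auto simp: carried_by_lipschitz_graphs_def)
  have G_borel: "\<Gamma> \<in> sets borel" if "\<Gamma> \<in> G" for \<Gamma>
    using G(2)[OF that] lipschitz_graph_closed borel_closed by blast
  then have "\<Union>G \<in> sets borel" using G(1) by (intro sets.countable_Union) auto
  then have "UNIV - \<Union>G \<in> null_sets \<mu>"
    using null pointwise_doubling_sets[OF \<mu>] by (auto simp: null_sets_def)
  then have "AE x in \<mu>. x \<in> \<Union>G" by (rule AE_I') auto
  moreover have "AE x in \<mu>. \<forall>\<Gamma>\<in>G. x \<in> \<Gamma> \<longrightarrow>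
      ((\<lambda>r. emeasure \<mu> (cball x r - \<Gamma>) / emeasure \<mu> (cball x r)) \<longlongrightarrow> 0) (at_right 0)"
    using G(1) G_borel pointwise_doubling_density[OF \<mu>] by (simp add: AE_ball_countable)
  ultimately show ?thesis
  proof eventually_elim
    case (elim x)
    then obtain \<Gamma> where \<Gamma>: "\<Gamma> \<in> G" "x \<in> \<Gamma>"
      and lim: "((\<lambda>r. emeasure \<mu> (cball x r - \<Gamma>) / emeasure \<mu> (cball x r)) \<longlongrightarrow> 0) (at_right 0)"
      by blast
    obtain V \<alpha> where V: "m_plane m V" "0 < \<alpha>" "\<alpha> < 1" "\<Gamma> \<subseteq> good_cone x V \<alpha>"
      using G(2)[OF \<Gamma>(1)] lipschitz_graph_in_good_cones \<Gamma>(2) by metis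
    have "emeasure \<mu> (bad_cone_ball x r V \<alpha>) / emeasure \<mu> (cball x r)
        \<le> emeasure \<mu> (cball x r - \<Gamma>) / emeasure \<mu> (cball x r)" for r
      using V(4) G_borel[OF \<Gamma>(1)] pointwise_doubling_sets[OF \<mu>]
      by (intro divide_right_mono_ennreal emeasure_mono) (auto simp: bad_cone_ball_def bad_cone_def)
    then have "((\<lambda>r. emeasure \<mu> (bad_cone_ball x r V \<alpha>) / emeasure \<mu> (cball x r)) \<longlongrightarrow> 0) (at_right 0)"
      by (intro tendsto_sandwich[OF _ _ tendsto_const lim]) auto
    then show ?case using V by blast
  qed
qed

theorem theoremD:
  fixes \<mu> :: "'a::{real_inner, polish_space} measure"
    and m :: nat
  assumes "pointwise_doubling \<mu>"
    and "m \<ge> 1"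
  shows "(AE x in \<mu>. \<exists>V \<alpha>. m_plane m V \<and> 0 < \<alpha> \<and> \<alpha> < 1 \<and>
            ((\<lambda>r. emeasure \<mu> (bad_cone_ball x r V \<alpha>) / emeasure \<mu> (cball x r)) \<longlongrightarrow> 0)
              (at_right 0))
         \<longleftrightarrow> carried_by_lipschitz_graphs m \<mu>"
  using cone_decay_imp_carried[OF assms(1)] carried_imp_cone_decay[OF assms(1)] by blast

end
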